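(* Let $n,m\ge1$, $f\in\mathcal S(\mathbb R^{n+m})$, $0<\beta<1$ and $1\le p<m/\beta$, and write $w=(x,v)\in\mathbb R^n\times\mathbb R^m$. Then $$\int_{\mathbb R^{n+m}\times\mathbb R^{n+m}}\frac{|f(w)-f(w')|^p}{|w-w'|^{n+m+p\beta}}\,dw\,dw'\ \ge\ G_{p,\beta}\int_{\mathbb R^n\times\mathbb R^m}|v|^{-p\beta}|f(w)|^p\,dw,$$ $$G_{p,\beta}=\frac{\pi^{n/2}\,\Gamma\!\left[\frac{m+p\beta}2\right]}{\Gamma\!\left[\frac{n+m+p\beta}2\right]}\int_{\mathbb R^m}\big|1-|x|^{-\lambda}\big|^p\,|x-\eta|^{-m-p\beta}\,dx,$$ where $\lambda=(m-p\beta)/p$ and $\eta\in S^{m-1}$ (the value does not depend on $\eta$).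
   Context: $\mathcal S(\mathbb R^{n+m})$ is the Schwartz class and $S^{m-1}$ the unit sphere in $\mathbb R^m$. *)

theory Defs
  imports "HOL-Analysis.Analysis"
begin

text \<open>
  Iterated partial derivatives are indexed by lists of coordinate directions; the list
  \<open>[b\<^sub>1, \<dots>, b\<^sub>k]\<close> stands for the derivative obtained by differentiating first in direction
  \<open>b\<^sub>k\<close> and last in direction \<open>b\<^sub>1\<close>. Derivatives are real ones, also for complex-valued
  functions.
\<close>

primrec iter_partial_deriv ::
    "'a::euclidean_space list \<Rightarrow> ('a \<Rightarrow> complex) \<Rightarrow> 'a \<Rightarrow> complex" where
  "iter_partial_deriv [] f = f"
| "iter_partial_deriv (b # bs) f =
     (\<lambda>x. frechet_derivative (iter_partial_deriv bs f) (at x) b)"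

text \<open>
  Differentiability of all iterated partial derivatives is the same as \<open>C\<^sup>\<infinity>\<close> smoothness, since
  a differentiable function is continuous; it also guarantees that \<^const>\<open>frechet_derivative\<close>
  is only applied where the derivative exists.
\<close>

definition schwartz :: "('a::euclidean_space \<Rightarrow> complex) \<Rightarrow> bool" where
  "schwartz f \<longleftrightarrow>
     (\<forall>bs. set bs \<subseteq> Basis \<longrightarrow>
        (\<forall>x. iter_partial_deriv bs f differentiable (at x)) \<and>
        (\<forall>k::nat. \<exists>C. \<forall>x. norm x ^ k * norm (iter_partial_deriv bs f x) \<le> C))"

text \<open>
  The constant, for given \<open>n\<close> and a unit vector \<open>\<eta>\<close> of \<open>\<real>\<^sup>m\<close>, \<open>m = CARD('m)\<close>. All integrals of
  nonnegative functions are taken in \<open>[0, \<infinity>]\<close>. The convention \<open>0 powr a = 0\<close> only affects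
  the integrand on the null set \<open>{0, \<eta>}\<close>.
\<close>

definition hardy_const :: "nat \<Rightarrow> real \<Rightarrow> real \<Rightarrow> real ^ 'm \<Rightarrow> ennreal" where
  "hardy_const n p \<beta> \<eta> =
     (let m = real CARD('m); l = (m - p * \<beta>) / p in
      ennreal (pi powr (real n / 2) * Gamma ((m + p * \<beta>) / 2)
               / Gamma ((real n + m + p * \<beta>) / 2)) *
      (\<integral>\<^sup>+ x. ennreal (\<bar>1 - norm x powr (- l)\<bar> powr p
                      * norm (x - \<eta>) powr (- m - p * \<beta>)) \<partial>lborel))"

end

theory Submission
  imports Defs "HOL-Probability.Distributions"
begin

text \<open>
Write \<open>w = (x, v)\<close>, \<open>a = p\<beta>\<close>, \<open>\<mu> = (m - a) / p\<close> and \<open>s = m + a\<close>. The function \<open>|v|\<^bsup>-\<mu>\<^esup>\<close> is the virtual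
ground state of the inequality: for \<open>\<omega> = (|v'| / |v|)\<^bsup>-\<mu>\<^esup> < 1\<close>, convexity of the \<open>p\<close>-th power gives
\<open>(1 - \<omega>)\<^bsup>p-1\<^esup> |f(w)|\<^bsup>p\<^esup> \<le> |f(w) - f(w')|\<^bsup>p\<^esup> + (1/\<omega> - 1)\<^bsup>p-1\<^esup> |f(w')|\<^bsup>p\<^esup>\<close>
(\<open>powr_norm_diff_ge\<close>). This is integrated against the kernel \<open>|w - w'|\<^bsup>-n-s\<^esup>\<close> over the pairs with
\<open>|v'| > |v|\<close>. Two facts turn the outer terms into multiples of the weighted norm
\<open>N = \<integral> |v|\<^bsup>-a\<^esup> |f(w)|\<^bsup>p\<^esup> dw\<close>.

\<^item> Integrating the kernel over the unweighted variable gives a multiple of \<open>|v - v'|\<^bsup>-s\<^esup>\<close>, with the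
  Gamma factors of the constant (\<open>nn_integral_marginal_kernel\<close>). Scaling and rotation then show that
  integrating over \<open>v'\<close> a function of \<open>|v'| / |v|\<close> against \<open>|v - v'|\<^bsup>-s\<^esup>\<close> gives \<open>|v|\<^bsup>-a\<^esup>\<close> times an integral
  over \<open>z\<close> with kernel \<open>|z - \<eta>|\<^bsup>-s\<^esup>\<close> (\<open>nn_integral_homogeneous_kernel\<close>). By rotation invariance this
  integral does not depend on \<open>\<eta>\<close>.

\<^item> Symmetry of the kernel yields an inversion formula relating a function of \<open>|z|\<close> to one of
  \<open>1 / |z|\<close> (\<open>unit_kernel_integral_inversion\<close>). It takes the place of polar coordinates and of the
  Jacobian of \<open>z \<mapsto> z / |z|\<^sup>2\<close>.

After inversion the two weights are \<open>(1 - \<omega>)\<^bsup>p-1\<^esup>\<close> and \<open>\<omega> (1 - \<omega>)\<^bsup>p-1\<^esup>\<close>, now with \<open>\<omega> = |z|\<^bsup>-\<mu>\<^esup>\<close>. Their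
difference is \<open>(1 - \<omega>)\<^bsup>p\<^esup>\<close>, the integrand of the constant. Each of the two weights alone may fail to be
integrable against the kernel near \<open>z = \<eta>\<close>, so the argument is carried out on \<open>|v'| > \<rho> |v|\<close> with \<open>\<rho> > 1\<close>
(\<open>truncated_energy_ge\<close>) and \<open>\<rho>\<close> tends to 1 at the end (\<open>energy_ge\<close>). The pairs with \<open>|v'| > |v|\<close> carry
at most half of the energy by symmetry, and the part \<open>|z| > 1\<close> carries half of the constant by
inversion (\<open>unit_kernel_integral_ratio_powr\<close>).

The subtraction also needs \<open>N\<close> to be finite, which follows from the decay of \<open>f\<close> and, as \<open>a < m\<close>,
the local integrability of \<open>|v|\<^bsup>-a\<^esup>\<close> (\<open>schwartz_weighted_norm_finite\<close>).
\<close>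

section \<open>Gaussian and Gamma integrals\<close>

lemma nn_integral_gaussian_real:
  assumes "0 < t"
  shows "(\<integral>\<^sup>+ (x::real). ennreal (exp (- t * x\<^sup>2)) \<partial>lborel) = ennreal (sqrt (pi / t))"
proof -
  define \<sigma> where "\<sigma> = 1 / sqrt (2 * t)"
  have \<sigma>: "0 < \<sigma>" "\<sigma>\<^sup>2 = 1 / (2 * t)" "2 * pi * \<sigma>\<^sup>2 = pi / t"
    using assms by (auto simp: \<sigma>_def power_divide)
  have eq: "exp (- t * x\<^sup>2) = sqrt (pi / t) * normal_density 0 \<sigma> x" for x
    using assms \<sigma> by (simp add: normal_density_def)
  have "(\<integral>\<^sup>+ (x::real). ennreal (exp (- t * x\<^sup>2)) \<partial>lborel)
      = ennreal (sqrt (pi / t)) * (\<integral>\<^sup>+ x. ennreal (normal_density 0 \<sigma> x) \<partial>lborel)"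
    unfolding eq using assms by (subst nn_integral_cmult [symmetric]) (auto simp: ennreal_mult)
  also have "(\<integral>\<^sup>+ x. ennreal (normal_density 0 \<sigma> x) \<partial>lborel) = 1"
    using \<sigma> by (subst nn_integral_eq_integral) (auto simp: integrable_normal_density)
  finally show ?thesis by simp
qed

lemma nn_integral_gaussian:
  assumes "0 < t"
  shows "(\<integral>\<^sup>+ (x::'a::euclidean_space). ennreal (exp (- t * (norm x)\<^sup>2)) \<partial>lborel)
    = ennreal ((pi / t) powr (real DIM('a) / 2))"
proof -
  have "exp (- t * (norm x)\<^sup>2) = (\<Prod>b\<in>Basis. exp (- t * (x \<bullet> b)\<^sup>2))" for x :: 'a
    by (simp add: exp_sum [symmetric] sum_distrib_left norm_eq_sqrt_inner euclidean_inner[of x x]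
        power2_eq_square sum_nonneg sum_negf)
  then have "(\<integral>\<^sup>+ (x::'a). ennreal (exp (- t * (norm x)\<^sup>2)) \<partial>lborel)
     = (\<integral>\<^sup>+ (x::'a). (\<Prod>b\<in>Basis. ennreal (exp (- t * (x \<bullet> b)\<^sup>2))) \<partial>lborel)"
    by (simp add: prod_ennreal)
  also have "\<dots> = (\<Prod>b\<in>(Basis::'a set). ennreal (sqrt (pi / t)))"
    using nn_integral_gaussian_real[OF assms]
    by (subst nn_integral_lborel_prod) simp_all
  also have "\<dots> = ennreal (sqrt (pi / t) ^ DIM('a))"
    using assms by (simp add: ennreal_power)
  also have "sqrt (pi / t) ^ DIM('a) = (pi / t) powr (real DIM('a) / 2)"
    using assms by (simp add: powr_half_sqrt [symmetric] powr_realpow [symmetric] powr_powr)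
  finally show ?thesis .
qed

lemma nn_integral_Gamma_scaled:
  assumes "0 < a" "0 < s"
  shows "(\<integral>\<^sup>+ t. ennreal (indicator {0<..} t * t powr (s - 1) * exp (- a * t)) \<partial>lborel)
    = ennreal (Gamma s * a powr (- s))"
proof -
  have "(\<integral>\<^sup>+ t. ennreal (indicator {0<..} t * t powr (s - 1) * exp (- a * t)) \<partial>lborel)
      = ennreal (1 / a) * (\<integral>\<^sup>+ t. ennreal (indicator {0<..} (0 + (1/a) * t) * (0 + (1/a) * t) powr (s - 1) * exp (- a * (0 + (1/a) * t))) \<partial>lborel)"
    using assms by (subst nn_integral_real_affine[where c="1/a" and t=0]) auto
  also have "\<dots> = ennreal (1 / a) * (\<integral>\<^sup>+ t. ennreal (a powr (1 - s)) * ennreal (indicator {0..} t * t powr (s - 1) / exp t) \<partial>lborel)"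
    using assms
    by (intro arg_cong[where f="\<lambda>x. ennreal (1/a) * x"] nn_integral_cong)
       (auto simp: ennreal_mult' [symmetric] indicator_def powr_divide exp_minus field_simps
                   powr_diff zero_less_divide_iff)
  also have "\<dots> = ennreal (1 / a * (a powr (1 - s) * Gamma s))"
    using assms Gamma_real_pos[of s] by (subst nn_integral_cmult)
       (auto simp: Gamma_conv_nn_integral_real [symmetric] ennreal_mult' [symmetric])
  also have "1 / a * (a powr (1 - s) * Gamma s) = Gamma s * a powr (- s)"
    using assms by (simp add: powr_diff powr_minus field_simps)
  finally show ?thesis .
qed

text \<open>
The Gamma integral writes \<open>\<Gamma>(q) (1 + |h|\<^sup>2)\<^bsup>-q\<^esup>\<close> as a superposition of Gaussians
\<open>e\<^bsup>-t|h|\<^sup>2\<^esup>\<close> with weight \<open>t\<^bsup>q-1\<^esup> e\<^bsup>-t\<^esup>\<close>; exchanging the integrals leaves a second Gamma integral.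
\<close>

lemma nn_integral_one_plus_norm_powr:
  assumes "real DIM('a) / 2 < q"
  shows "(\<integral>\<^sup>+ (h::'a::euclidean_space). ennreal ((1 + (norm h)\<^sup>2) powr (- q)) \<partial>lborel)
    = ennreal (pi powr (real DIM('a) / 2) * Gamma (q - real DIM('a) / 2) / Gamma q)"
proof -
  let ?n = "real DIM('a) / 2"
  have q: "0 < q" using assms by (rule le_less_trans[rotated]) simp
  have G: "0 < Gamma q" "0 < Gamma (q - ?n)" using q assms by (auto intro: Gamma_real_pos)
  let ?F = "\<lambda>(h::'a) t. ennreal (indicator {0<..} t * t powr (q - 1) * exp (- (1 + (norm h)\<^sup>2) * t))"
  have "ennreal (Gamma q) * (\<integral>\<^sup>+ (h::'a). ennreal ((1 + (norm h)\<^sup>2) powr (- q)) \<partial>lborel)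
    = (\<integral>\<^sup>+ (h::'a). ennreal (Gamma q * (1 + (norm h)\<^sup>2) powr (- q)) \<partial>lborel)"
    using G by (subst nn_integral_cmult[symmetric]) (auto simp: ennreal_mult)
  also have "\<dots> = (\<integral>\<^sup>+ h. \<integral>\<^sup>+ t. ?F h t \<partial>lborel \<partial>lborel)"
    by (intro nn_integral_cong nn_integral_Gamma_scaled[symmetric] q) (simp add: add_pos_nonneg)
  also have "\<dots> = (\<integral>\<^sup>+ t. \<integral>\<^sup>+ h. ?F h t \<partial>lborel \<partial>lborel)"
    by (rule lborel_pair.Fubini') measurable
  also have "\<dots> = (\<integral>\<^sup>+ t. ennreal (pi powr ?n) * ennreal (indicator {0<..} t * t powr (q - ?n - 1) * exp (- 1 * t)) \<partial>lborel)"
  proof (intro nn_integral_cong)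
    fix t :: real
    show "(\<integral>\<^sup>+ h. ?F h t \<partial>lborel) = ennreal (pi powr ?n) * ennreal (indicator {0<..} t * t powr (q - ?n - 1) * exp (- 1 * t))"
    proof (cases "0 < t")
      case True
      have "(\<integral>\<^sup>+ h. ?F h t \<partial>lborel) = (\<integral>\<^sup>+ (h::'a). ennreal (t powr (q - 1) * exp (- t)) * ennreal (exp (- t * (norm h)\<^sup>2)) \<partial>lborel)"
        using True by (intro nn_integral_cong) (simp add: ennreal_mult' [symmetric] exp_add [symmetric] exp_diff [symmetric] algebra_simps)
      also have "\<dots> = ennreal (t powr (q - 1) * exp (- t) * (pi / t) powr ?n)"
        using True using nn_integral_gaussian[of t, where 'a='a]
          by (subst nn_integral_cmult) (simp_all add: ennreal_mult')
      also have "t powr (q - 1) * exp (- t) * (pi / t) powr ?n = pi powr ?n * (t powr (q - ?n - 1) * exp (- t))"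
      proof -
        have "t powr (q - 1) = t powr (q - ?n - 1) * t powr ?n"
          by (simp add: powr_add [symmetric])
        then show ?thesis using True by (simp add: powr_divide)
      qed
      finally show ?thesis using True by (simp add: ennreal_mult)
    qed simp
  qed
  also have "\<dots> = ennreal (pi powr ?n * Gamma (q - ?n))"
    using assms nn_integral_Gamma_scaled[of 1 "q - ?n"]
    by (subst nn_integral_cmult) (simp_all add: ennreal_mult')
  finally have "ennreal (1 / Gamma q) * (ennreal (Gamma q) * (\<integral>\<^sup>+ (h::'a). ennreal ((1 + (norm h)\<^sup>2) powr (- q)) \<partial>lborel))
    = ennreal (1 / Gamma q) * ennreal (pi powr ?n * Gamma (q - ?n))" by simp
  then show ?thesis using G
    by (simp add: mult.assoc [symmetric] ennreal_mult [symmetric])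
qed

section \<open>Symmetries of Lebesgue measure\<close>

lemma nn_integral_lborel_affine:
  fixes F :: "'a::euclidean_space \<Rightarrow> ennreal"
  assumes [measurable]: "F \<in> borel_measurable borel" and "0 < c"
  shows "(\<integral>\<^sup>+ x. F x \<partial>lborel) = ennreal (c ^ DIM('a)) * (\<integral>\<^sup>+ x. F (a + c *\<^sub>R x) \<partial>lborel)"
  using assms
  by (subst lborel_affine[of c a])
     (simp_all add: nn_integral_density nn_integral_distr nn_integral_cmult)

lemma nn_integral_lborel_translate:
  fixes F :: "'a::euclidean_space \<Rightarrow> ennreal"
  assumes "F \<in> borel_measurable borel"
  shows "(\<integral>\<^sup>+ x. F (a + x) \<partial>lborel) = (\<integral>\<^sup>+ x. F x \<partial>lborel)"
  using nn_integral_lborel_affine[OF assms, of 1 a] by simp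

text \<open>
Only translation invariance of Lebesgue measure is used, together with one rotationally
symmetric weight \<open>g\<close> of finite positive mass \<open>c\<close>, here a Gaussian. In the double integral of
\<open>g y * F (T x)\<close>, shifting first \<open>x\<close> by the preimage of \<open>y\<close> under \<open>T\<close> and then \<open>y\<close> by \<open>- T x\<close> moves
\<open>T\<close> from \<open>F\<close> into \<open>g\<close>, where it is invisible. Both integrals of \<open>F\<close>, multiplied by \<open>c\<close>, therefore
agree.
\<close>

lemma nn_integral_lborel_orthogonal:
  fixes F :: "'a::euclidean_space \<Rightarrow> ennreal" and T :: "'a \<Rightarrow> 'a"
  assumes [measurable]: "F \<in> borel_measurable borel" and T: "orthogonal_transformation T"
  shows "(\<integral>\<^sup>+ x. F (T x) \<partial>lborel) = (\<integral>\<^sup>+ x. F x \<partial>lborel)"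
proof -
  have lin: "linear T" using T by (rule orthogonal_transformation_linear)
  then have [measurable]: "T \<in> borel_measurable borel"
    by (intro borel_measurable_continuous_onI linear_continuous_on) (simp add: linear_conv_bounded_linear)
  define S where "S = inv T"
  have TS: "T (S y) = y" for y
    unfolding S_def
    using orthogonal_transformation_surj[OF T] by (rule surj_f_inv_f)
  have nT: "norm (T x) = norm x" for x using T by (simp add: orthogonal_transformation_norm)
  define g where "g x = ennreal (exp (- 1 * (norm x)\<^sup>2))" for x :: 'a
  have [measurable]: "g \<in> borel_measurable borel" unfolding g_def by measurable
  define c where "c = (\<integral>\<^sup>+ x. g x \<partial>lborel)"
  have c: "c = ennreal (pi powr (real DIM('a) / 2))"
    using nn_integral_gaussian[of 1, where 'a='a] unfolding c_def g_def by simp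
  have "c * (\<integral>\<^sup>+ x. F (T x) \<partial>lborel) = (\<integral>\<^sup>+ y. \<integral>\<^sup>+ x. g y * F (T x) \<partial>lborel \<partial>lborel)"
    unfolding c_def by (simp add: nn_integral_cmult nn_integral_multc)
  also have "\<dots> = (\<integral>\<^sup>+ y. \<integral>\<^sup>+ x. g y * F (T x + y) \<partial>lborel \<partial>lborel)"
  proof (rule nn_integral_cong)
    fix y
    have "(\<integral>\<^sup>+ x. g y * F (T x) \<partial>lborel) = (\<integral>\<^sup>+ x. g y * F (T (S y + x)) \<partial>lborel)"
      using nn_integral_lborel_translate[of "\<lambda>x. g y * F (T x)" "S y"] by simp
    then show "(\<integral>\<^sup>+ x. g y * F (T x) \<partial>lborel) = (\<integral>\<^sup>+ x. g y * F (T x + y) \<partial>lborel)"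
      by (simp add: linear_add[OF lin] TS add.commute)
  qed
  also have "\<dots> = (\<integral>\<^sup>+ x. \<integral>\<^sup>+ y. g y * F (T x + y) \<partial>lborel \<partial>lborel)"
    by (rule lborel_pair.Fubini') measurable
  also have "\<dots> = (\<integral>\<^sup>+ x. \<integral>\<^sup>+ y. g (y - T x) * F y \<partial>lborel \<partial>lborel)"
  proof (rule nn_integral_cong)
    fix x
    show "(\<integral>\<^sup>+ y. g y * F (T x + y) \<partial>lborel) = (\<integral>\<^sup>+ y. g (y - T x) * F y \<partial>lborel)"
      using nn_integral_lborel_translate[of "\<lambda>y. g (y - T x) * F y" "T x"] by simp
  qed
  also have "\<dots> = (\<integral>\<^sup>+ y. \<integral>\<^sup>+ x. g (y - T x) * F y \<partial>lborel \<partial>lborel)"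
    by (rule lborel_pair.Fubini') measurable
  also have "\<dots> = (\<integral>\<^sup>+ y. c * F y \<partial>lborel)"
  proof (rule nn_integral_cong)
    fix y
    have "g (y - T x) = g (- S y + x)" for x
    proof -
      have "norm (y - T x) = norm (T (S y - x))" by (simp add: linear_diff[OF lin] TS)
      also have "\<dots> = norm (- S y + x)" by (simp add: nT norm_minus_commute)
      finally show ?thesis by (simp add: g_def)
    qed
    then have "(\<integral>\<^sup>+ x. g (y - T x) * F y \<partial>lborel) = (\<integral>\<^sup>+ x. g (- S y + x) * F y \<partial>lborel)" by simp
    also have "\<dots> = (\<integral>\<^sup>+ x. g x * F y \<partial>lborel)"
      using nn_integral_lborel_translate[of "\<lambda>x. g x * F y" "- S y"] by simp
    finally show "(\<integral>\<^sup>+ x. g (y - T x) * F y \<partial>lborel) = c * F y"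
      by (simp add: c_def nn_integral_multc)
  qed
  also have "\<dots> = c * (\<integral>\<^sup>+ y. F y \<partial>lborel)" by (simp add: nn_integral_cmult)
  finally show ?thesis
    unfolding c by (simp add: ennreal_mult_cancel_left)
qed

section \<open>The homogeneous kernel against radial functions\<close>

text \<open>
With \<open>s = m + a\<close> and \<open>m = CARD('m)\<close>, the kernel \<open>|z - \<eta>|\<^bsup>-s\<^esup>\<close> is what remains of
\<open>|v - v'|\<^bsup>-s\<^esup>\<close> once \<open>v\<close> is normalised to the unit vector \<open>\<eta>\<close>. The weight \<open>H\<close> is a function of the
ratio of the two norms.
\<close>

definition unit_kernel_integral :: "real \<Rightarrow> real ^ 'm \<Rightarrow> (real \<Rightarrow> ennreal) \<Rightarrow> ennreal" where
  "unit_kernel_integral s \<eta> H = (\<integral>\<^sup>+ z. ennreal (norm (z - \<eta>) powr (- s)) * H (norm z) \<partial>lborel)"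

lemma unit_kernel_integral_rotate:
  fixes \<eta> \<eta>' :: "real ^ 'm"
  assumes [measurable]: "H \<in> borel_measurable borel" and "norm \<eta> = 1" "norm \<eta>' = 1"
  shows "unit_kernel_integral s \<eta> H = unit_kernel_integral s \<eta>' H"
proof -
  obtain T where T: "orthogonal_transformation T" "T \<eta> = \<eta>'"
    using orthogonal_transformation_exists_1 assms by metis
  have nT: "norm (T x) = norm x" for x using T(1) by (simp add: orthogonal_transformation_norm)
  have "norm (T z - \<eta>') = norm (z - \<eta>)" for z
    using nT[of "z - \<eta>"] T by (simp add: linear_diff orthogonal_transformation_linear)
  then have "unit_kernel_integral s \<eta> H
      = (\<integral>\<^sup>+ z. ennreal (norm (T z - \<eta>') powr (- s)) * H (norm (T z)) \<partial>lborel)"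
    by (simp add: unit_kernel_integral_def nT)
  also have "\<dots> = unit_kernel_integral s \<eta>' H"
    unfolding unit_kernel_integral_def by (rule nn_integral_lborel_orthogonal[OF _ T(1)]) measurable
  finally show ?thesis .
qed

text \<open>
Substituting \<open>y = |x| z\<close> normalises \<open>x\<close> to a unit vector, and rotation invariance replaces that
vector by \<open>\<eta>\<close>.
\<close>

lemma nn_integral_homogeneous_kernel:
  fixes x \<eta> :: "real ^ 'm"
  assumes [measurable]: "H \<in> borel_measurable borel" and "norm \<eta> = 1" and "x \<noteq> 0"
  shows "(\<integral>\<^sup>+ y. ennreal (norm (x - y) powr (- s)) * H (norm y / norm x) \<partial>lborel)
    = ennreal (norm x powr (real CARD('m) - s)) * unit_kernel_integral s \<eta> H"
proof -
  let ?e = "x /\<^sub>R norm x"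
  have x: "0 < norm x" using assms by simp
  have dist: "norm (x - norm x *\<^sub>R z) = norm x * norm (z - ?e)" for z
  proof -
    have "x - norm x *\<^sub>R z = norm x *\<^sub>R (?e - z)" using x by (simp add: scaleR_diff_right)
    then show ?thesis by (simp add: norm_minus_commute)
  qed
  have "(\<integral>\<^sup>+ y. ennreal (norm (x - y) powr (- s)) * H (norm y / norm x) \<partial>lborel)
    = ennreal (norm x ^ CARD('m)) * (\<integral>\<^sup>+ z. ennreal (norm (x - (0 + norm x *\<^sub>R z)) powr (- s))
         * H (norm (0 + norm x *\<^sub>R z) / norm x) \<partial>lborel)"
    using nn_integral_lborel_affine[OF _ x, of "\<lambda>y. ennreal (norm (x - y) powr (- s)) * H (norm y / norm x)" 0]
    by simp
  also have "\<dots> = ennreal (norm x ^ CARD('m)) * (\<integral>\<^sup>+ z. ennreal (norm x powr (- s)) *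
      (ennreal (norm (z - ?e) powr (- s)) * H (norm z)) \<partial>lborel)"
    using x by (simp add: dist powr_mult ennreal_mult mult.assoc)
  also have "\<dots> = ennreal (norm x ^ CARD('m)) * (ennreal (norm x powr (- s)) * unit_kernel_integral s ?e H)"
    by (simp add: nn_integral_cmult unit_kernel_integral_def)
  also have "unit_kernel_integral s ?e H = unit_kernel_integral s \<eta> H"
    using assms by (intro unit_kernel_integral_rotate) auto
  also have "ennreal (norm x ^ CARD('m)) * (ennreal (norm x powr (- s)) * unit_kernel_integral s \<eta> H)
     = ennreal (norm x powr (real CARD('m) - s)) * unit_kernel_integral s \<eta> H"
    using x by (simp add: mult.assoc [symmetric] ennreal_mult' [symmetric] powr_realpow [symmetric] powr_add [symmetric])
  finally show ?thesis .
qed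

text \<open>
This is the substitution \<open>z \<mapsto> z / |z|\<^sup>2\<close>, obtained without a Jacobian from the symmetry of the
kernel. The double integral of \<open>|x - y|\<^bsup>-s\<^esup> H(|y| / |x|)\<close> against a radial weight \<open>\<phi>(|x|)\<close> is computed
in two ways. Integrating over \<open>y\<close> first gives the left-hand side, integrating over \<open>x\<close> first turns the
ratio into its reciprocal and gives the right-hand side, both multiplied by the same constant. The
weight is chosen so that this constant is a Gaussian integral.
\<close>

lemma unit_kernel_integral_inversion:
  fixes \<eta> :: "real ^ 'm"
  assumes [measurable]: "H \<in> borel_measurable borel" and \<eta>: "norm \<eta> = 1"
  shows "unit_kernel_integral s \<eta> H
    = unit_kernel_integral s \<eta> (\<lambda>r. ennreal (r powr (s - 2 * real CARD('m))) * H (1 / r))"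
proof -
  let ?m = "real CARD('m)"
  \<comment> \<open>The power compensates the factor \<open>|x|\<^bsup>m-s\<^esup>\<close> that integration over \<open>y\<close> produces.\<close>
  define \<phi> where "\<phi> r = ennreal (r powr (s - ?m) * exp (- 1 * r\<^sup>2))" for r :: real
  have [measurable]: "\<phi> \<in> borel_measurable borel" unfolding \<phi>_def by measurable
  define k where "k x y = ennreal (norm (x - y) powr (- s))" for x y :: "real ^ 'm"
  have k_sym: "k x y = k y x" for x y by (simp add: k_def norm_minus_commute)
  have k_meas [measurable]: "(\<lambda>x. k (f x) (g x)) \<in> borel_measurable M"
    if [measurable]: "f \<in> borel_measurable M" "g \<in> borel_measurable M" for f g and M :: "'z measure"
    unfolding k_def by measurable
  have ne0: "AE x in lborel. x \<noteq> (0 :: real ^ 'm)" by (rule AE_lborel_singleton)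
  define c where "c = (\<integral>\<^sup>+ (x::real ^ 'm). ennreal (exp (- 1 * (norm x)\<^sup>2)) \<partial>lborel)"
  have c: "c = ennreal (pi powr (?m / 2))"
    using nn_integral_gaussian[of 1, where 'a="real ^ 'm"] unfolding c_def by simp
  have "c * unit_kernel_integral s \<eta> H
    = (\<integral>\<^sup>+ (x::real ^ 'm). ennreal (exp (- 1 * (norm x)\<^sup>2)) * unit_kernel_integral s \<eta> H \<partial>lborel)"
    unfolding c_def by (simp add: nn_integral_multc)
  also have "\<dots> = (\<integral>\<^sup>+ x. \<integral>\<^sup>+ y. \<phi> (norm x) * (k x y * H (norm y / norm x)) \<partial>lborel \<partial>lborel)"
  proof (intro nn_integral_cong_AE, use ne0 in eventually_elim)
    fix x :: "real ^ 'm" assume x: "x \<noteq> 0"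
    have "ennreal (exp (- 1 * (norm x)\<^sup>2)) = \<phi> (norm x) * ennreal (norm x powr (?m - s))"
      using x by (simp add: \<phi>_def ennreal_mult' [symmetric] powr_diff)
    then show "ennreal (exp (- 1 * (norm x)\<^sup>2)) * unit_kernel_integral s \<eta> H
      = (\<integral>\<^sup>+ y. \<phi> (norm x) * (k x y * H (norm y / norm x)) \<partial>lborel)"
      using nn_integral_homogeneous_kernel[OF assms x, of s]
      by (simp add: nn_integral_cmult mult.assoc k_def)
  qed
  also have "\<dots> = (\<integral>\<^sup>+ y. \<integral>\<^sup>+ x. \<phi> (norm x) * (k x y * H (norm y / norm x)) \<partial>lborel \<partial>lborel)"
    by (rule lborel_pair.Fubini') measurable
  also have "\<dots> = (\<integral>\<^sup>+ (y :: real ^ 'm). \<integral>\<^sup>+ z. ennreal (norm y powr (?m - s)) *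
      (k z \<eta> * (\<phi> (norm y * norm z) * H (1 / norm z))) \<partial>lborel \<partial>lborel)"
  proof (intro nn_integral_cong_AE, use ne0 in eventually_elim)
    fix y :: "real ^ 'm" assume y: "y \<noteq> 0"
    have "(\<integral>\<^sup>+ x. \<phi> (norm x) * (k x y * H (norm y / norm x)) \<partial>lborel)
       = (\<integral>\<^sup>+ x. ennreal (norm (y - x) powr (- s)) *
           (\<phi> (norm y * (norm x / norm y)) * H (1 / (norm x / norm y))) \<partial>lborel)"
      using y by (simp add: k_def norm_minus_commute mult_ac)
    also have "\<dots> = ennreal (norm y powr (?m - s)) *
       unit_kernel_integral s \<eta> (\<lambda>q. \<phi> (norm y * q) * H (1 / q))"
      by (rule nn_integral_homogeneous_kernel[OF _ \<eta> y]) measurable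
    also have "\<dots> = (\<integral>\<^sup>+ z. ennreal (norm y powr (?m - s)) *
      (k z \<eta> * (\<phi> (norm y * norm z) * H (1 / norm z))) \<partial>lborel)"
      unfolding unit_kernel_integral_def k_def by (subst nn_integral_cmult) measurable
    finally show "(\<integral>\<^sup>+ x. \<phi> (norm x) * (k x y * H (norm y / norm x)) \<partial>lborel) = \<dots>" .
  qed
  also have "\<dots> = (\<integral>\<^sup>+ z. \<integral>\<^sup>+ (y :: real ^ 'm). ennreal (norm y powr (?m - s)) *
      (k z \<eta> * (\<phi> (norm y * norm z) * H (1 / norm z))) \<partial>lborel \<partial>lborel)"
    by (rule lborel_pair.Fubini') measurable
  also have "\<dots> = (\<integral>\<^sup>+ z. c * (k z \<eta> * (ennreal (norm z powr (s - 2 * ?m)) * H (1 / norm z))) \<partial>lborel)"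
  proof (intro nn_integral_cong_AE, use ne0 in eventually_elim)
    fix z :: "real ^ 'm" assume z: "z \<noteq> 0"
    have "(\<integral>\<^sup>+ (y :: real ^ 'm). ennreal (norm y powr (?m - s)) * (k z \<eta> * (\<phi> (norm y * norm z) * H (1 / norm z))) \<partial>lborel)
       = (\<integral>\<^sup>+ (y :: real ^ 'm). (k z \<eta> * H (1 / norm z) * ennreal (norm z powr (s - ?m)))
            * ennreal (exp (- ((norm z)\<^sup>2) * (norm y)\<^sup>2)) \<partial>lborel)"
    proof (intro nn_integral_cong_AE, use ne0 in eventually_elim)
      fix y :: "real ^ 'm" assume y: "y \<noteq> 0"
      have "norm y powr (?m - s) * ((norm y * norm z) powr (s - ?m) * exp (- 1 * (norm y * norm z)\<^sup>2))
        = norm z powr (s - ?m) * exp (- ((norm z)\<^sup>2) * (norm y)\<^sup>2)"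
        using y z by (simp add: powr_mult powr_diff power_mult_distrib mult_ac)
      then have *: "ennreal (norm y powr (?m - s)) * \<phi> (norm y * norm z)
        = ennreal (norm z powr (s - ?m)) * ennreal (exp (- ((norm z)\<^sup>2) * (norm y)\<^sup>2))"
        unfolding \<phi>_def by (simp only: ennreal_mult' [symmetric] powr_ge_zero)
      have "ennreal (norm y powr (?m - s)) * (k z \<eta> * (\<phi> (norm y * norm z) * H (1 / norm z)))
        = k z \<eta> * H (1 / norm z) * (ennreal (norm y powr (?m - s)) * \<phi> (norm y * norm z))"
        by (simp only: mult_ac)
      then show "ennreal (norm y powr (?m - s)) * (k z \<eta> * (\<phi> (norm y * norm z) * H (1 / norm z)))
        = (k z \<eta> * H (1 / norm z) * ennreal (norm z powr (s - ?m))) * ennreal (exp (- ((norm z)\<^sup>2) * (norm y)\<^sup>2))"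
        by (simp only: * mult.assoc)
    qed
    also have "\<dots> = k z \<eta> * H (1 / norm z) * ennreal (norm z powr (s - ?m)) * ennreal ((pi / (norm z)\<^sup>2) powr (?m / 2))"
      using z nn_integral_gaussian[of "(norm z)\<^sup>2", where 'a="real ^ 'm"] by (subst nn_integral_cmult) simp_all
    also have "\<dots> = k z \<eta> * H (1 / norm z) * ennreal (norm z powr (s - ?m) * (pi / (norm z)\<^sup>2) powr (?m / 2))"
      by (simp add: ennreal_mult mult.assoc)
    also have "norm z powr (s - ?m) * (pi / (norm z)\<^sup>2) powr (?m / 2) = pi powr (?m / 2) * norm z powr (s - 2 * ?m)"
    proof -
      have "((norm z)\<^sup>2) powr (?m / 2) = norm z powr ?m"
        using z powr_realpow[of "norm z" 2] powr_powr[of "norm z" 2 "?m / 2"] by simp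
      moreover have "norm z powr (s - ?m) = norm z powr (s - 2 * ?m) * norm z powr ?m"
        by (simp add: powr_add [symmetric])
      ultimately show ?thesis using z by (simp add: powr_divide)
    qed
    finally show "(\<integral>\<^sup>+ (y :: real ^ 'm). ennreal (norm y powr (?m - s)) * (k z \<eta> * (\<phi> (norm y * norm z) * H (1 / norm z))) \<partial>lborel)
      = c * (k z \<eta> * (ennreal (norm z powr (s - 2 * ?m)) * H (1 / norm z)))"
      unfolding c by (simp add: ennreal_mult mult_ac)
  qed
  also have "\<dots> = c * unit_kernel_integral s \<eta> (\<lambda>r. ennreal (r powr (s - 2 * ?m)) * H (1 / r))"
    unfolding unit_kernel_integral_def k_def by (subst nn_integral_cmult) measurable
  finally show ?thesis unfolding c by (simp add: ennreal_mult_cancel_left)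
qed

text \<open>
Integrating out the variable in which no weight is present: scaling by \<open>d\<close> reduces the integral to
that of \<open>(1 + |h|\<^sup>2)\<^bsup>-q\<^esup>\<close> with \<open>q = (n + s) / 2\<close>, which is the source of the Gamma factors in the
constant.
\<close>

lemma nn_integral_marginal_kernel:
  fixes x :: "'a::euclidean_space"
  assumes "0 < d" "0 < s"
  shows "(\<integral>\<^sup>+ x'. ennreal (1 / sqrt ((norm (x - x'))\<^sup>2 + d\<^sup>2) powr (real DIM('a) + s)) \<partial>lborel)
    = ennreal (pi powr (real DIM('a) / 2) * Gamma (s / 2) / Gamma ((real DIM('a) + s) / 2)) * ennreal (d powr (- s))"
proof -
  let ?n = "real DIM('a)"
  let ?q = "(?n + s) / 2"
  have "(\<integral>\<^sup>+ x'. ennreal (1 / sqrt ((norm (x - x'))\<^sup>2 + d\<^sup>2) powr (?n + s)) \<partial>lborel)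
    = ennreal (d ^ DIM('a)) * (\<integral>\<^sup>+ (h::'a). ennreal (1 / sqrt ((norm (x - (x + d *\<^sub>R h)))\<^sup>2 + d\<^sup>2) powr (?n + s)) \<partial>lborel)"
    using assms by (intro nn_integral_lborel_affine) measurable
  also have "\<dots> = ennreal (d ^ DIM('a)) * (\<integral>\<^sup>+ (h::'a). ennreal (d powr (- (?n + s))) * ennreal ((1 + (norm h)\<^sup>2) powr (- ?q)) \<partial>lborel)"
  proof (intro arg_cong[where f="\<lambda>x. _ * x"] nn_integral_cong)
    fix h :: 'a
    have "sqrt ((norm (x - (x + d *\<^sub>R h)))\<^sup>2 + d\<^sup>2) = d * sqrt (1 + (norm h)\<^sup>2)"
      using assms by (intro real_sqrt_unique) (auto simp: power_mult_distrib algebra_simps)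
    also have "1 / \<dots> powr (?n + s) = d powr (- (?n + s)) * sqrt (1 + (norm h)\<^sup>2) powr (- (?n + s))"
      using assms by (simp only: powr_mult powr_minus inverse_eq_divide) simp
    also have "sqrt (1 + (norm h)\<^sup>2) powr (- (?n + s)) = (1 + (norm h)\<^sup>2) powr (- ?q)"
    proof -
      have "1 / 2 * (- (?n + s)) = - ?q" by linarith
      then show ?thesis
        by (simp only: powr_half_sqrt [symmetric] powr_powr add_nonneg_nonneg zero_le_one zero_le_power2)
    qed
    finally show "ennreal (1 / sqrt ((norm (x - (x + d *\<^sub>R h)))\<^sup>2 + d\<^sup>2) powr (?n + s))
      = ennreal (d powr (- (?n + s))) * ennreal ((1 + (norm h)\<^sup>2) powr (- ?q))"
      by (simp only: ennreal_mult' [symmetric] powr_ge_zero)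
  qed
  also have "\<dots> = ennreal (d ^ DIM('a)) * (ennreal (d powr (- (?n + s))) * ennreal (pi powr (?n / 2) * Gamma (?q - ?n / 2) / Gamma ?q))"
    using assms by (subst nn_integral_cmult) (auto simp: nn_integral_one_plus_norm_powr)
  also have "\<dots> = ennreal (d ^ DIM('a) * d powr (- (?n + s))) * ennreal (pi powr (?n / 2) * Gamma (?q - ?n / 2) / Gamma ?q)"
    using assms by (simp add: ennreal_mult mult.assoc)
  also have "d ^ DIM('a) * d powr (- (?n + s)) = d powr (- s)"
    using assms by (simp add: powr_realpow [symmetric] powr_add [symmetric])
  also have "?q - ?n / 2 = s / 2" by (simp add: field_simps)
  finally show ?thesis by (simp only: mult.commute)
qed

lemma nn_integral_product_kernel:
  fixes x :: "'a::euclidean_space" and v \<eta> :: "real ^ 'm"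
  assumes [measurable]: "H \<in> borel_measurable borel" and \<eta>: "norm \<eta> = 1" and v: "v \<noteq> 0" and s: "0 < s"
  shows "(\<integral>\<^sup>+ w'. ennreal (1 / norm ((x, v) - w') powr (real DIM('a) + s)) * H (norm (snd w') / norm v) \<partial>lborel)
    = ennreal (pi powr (real DIM('a) / 2) * Gamma (s / 2) / Gamma ((real DIM('a) + s) / 2))
      * unit_kernel_integral s \<eta> H * ennreal (norm v powr (real CARD('m) - s))"
proof -
  let ?n = "real DIM('a)"
  let ?c = "ennreal (pi powr (?n / 2) * Gamma (s / 2) / Gamma ((?n + s) / 2))"
  have [measurable]: "(snd :: 'a \<times> (real ^ 'm) \<Rightarrow> _) \<in> borel_measurable borel"
    by (intro borel_measurable_continuous_onI continuous_intros)
  have meas: "(\<lambda>w'. ennreal (1 / norm ((x, v) - w') powr (?n + s)) * H (norm (snd w') / norm v)) \<in> borel_measurable lborel"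
    by measurable
  have "(\<integral>\<^sup>+ w'. ennreal (1 / norm ((x, v) - w') powr (?n + s)) * H (norm (snd w') / norm v) \<partial>lborel)
    = (\<integral>\<^sup>+ w'. ennreal (1 / norm ((x, v) - w') powr (?n + s)) * H (norm (snd w') / norm v) \<partial>(lborel \<Otimes>\<^sub>M lborel))"
    by (simp add: lborel_prod)
  also have "\<dots> = (\<integral>\<^sup>+ v'. \<integral>\<^sup>+ x'. ennreal (1 / norm ((x, v) - (x', v')) powr (?n + s)) * H (norm v' / norm v) \<partial>lborel \<partial>lborel)"
    using meas by (subst lborel_pair.nn_integral_snd [symmetric]) (simp_all add: lborel_prod)
  also have "\<dots> = (\<integral>\<^sup>+ v'. ?c * (ennreal (norm (v - v') powr (- s)) * H (norm v' / norm v)) \<partial>lborel)"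
  proof (intro nn_integral_cong_AE, use AE_lborel_singleton[of v] in eventually_elim)
    fix v' assume "v' \<noteq> v"
    then have "0 < norm (v - v')" by simp
    from nn_integral_marginal_kernel[OF this s, of x]
    show "(\<integral>\<^sup>+ x'. ennreal (1 / norm ((x, v) - (x', v')) powr (?n + s)) * H (norm v' / norm v) \<partial>lborel)
      = ?c * (ennreal (norm (v - v') powr (- s)) * H (norm v' / norm v))"
      by (subst nn_integral_multc) (simp_all add: norm_Pair mult.assoc)
  qed
  also have "\<dots> = ?c * (ennreal (norm v powr (real CARD('m) - s)) * unit_kernel_integral s \<eta> H)"
    using nn_integral_homogeneous_kernel[OF assms(1) \<eta> v, of s] by (subst nn_integral_cmult) simp_all
  finally show ?thesis by (simp only: mult_ac)
qed

section \<open>The pointwise inequality\<close>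

text \<open>
Convexity of the \<open>p\<close>-th power, applied to the weights \<open>1 - \<omega>\<close> and \<open>\<omega>\<close> in
\<open>X + Y = (1 - \<omega>) * (X / (1 - \<omega>)) + \<omega> * (Y / \<omega>)\<close>, where \<open>X = |a - b|\<close> and \<open>Y = |b|\<close>. Equality holds for
\<open>b = \<omega> a\<close>, that is, when \<open>\<omega>\<close> is the ratio of two values of the virtual ground state.
\<close>

lemma powr_norm_diff_ge:
  fixes a b :: "'a::real_normed_vector"
  assumes p: "1 \<le> p" and \<omega>: "0 < \<omega>" "\<omega> < 1"
  shows "(1 - \<omega>) powr (p - 1) * norm a powr p
    \<le> norm (a - b) powr p + (1 / \<omega> - 1) powr (p - 1) * norm b powr p"
proof -
  define X where "X = norm (a - b)"
  define Y where "Y = norm b"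
  have nonneg: "0 \<le> X" "0 \<le> Y" by (auto simp: X_def Y_def)
  have tri: "norm a \<le> X + Y" unfolding X_def Y_def by (metis diff_add_cancel norm_triangle_ineq)
  have le1: "(1 - \<omega>) powr (p - 1) \<le> 1" using assms powr_mono2[of "p - 1" "1 - \<omega>" 1] by simp
  have "\<omega> * (1 - \<omega>) \<le> 1 - \<omega>" using \<omega> by simp
  then have ratio: "1 - \<omega> \<le> 1 / \<omega> - 1" using \<omega> by (simp add: field_simps)
  have "(1 - \<omega>) powr (p - 1) * (X + Y) powr p \<le> X powr p + (1 / \<omega> - 1) powr (p - 1) * Y powr p"
  proof (cases "X = 0 \<or> Y = 0")
    case True
    then show ?thesis
    proof
      assume "X = 0"
      then show ?thesis using p \<omega> ratio by (auto intro!: mult_right_mono powr_mono2)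
    next
      assume "Y = 0"
      then show ?thesis using p mult_right_mono[OF le1, of "X powr p"] by simp
    qed
  next
    case False
    then have pos: "0 < X" "0 < Y" using nonneg by auto
    have "((1 - \<omega>) *\<^sub>R (X / (1 - \<omega>)) + \<omega> *\<^sub>R (Y / \<omega>)) powr p
      \<le> (1 - \<omega>) * (X / (1 - \<omega>)) powr p + \<omega> * (Y / \<omega>) powr p"
      using pos \<omega> by (intro convex_onD[OF powr_convex[OF p]]) auto
    then have "(X + Y) powr p \<le> (1 - \<omega>) * (X / (1 - \<omega>)) powr p + \<omega> * (Y / \<omega>) powr p"
      using \<omega> by simp
    then have "(1 - \<omega>) powr (p - 1) * (X + Y) powr p
      \<le> (1 - \<omega>) powr (p - 1) * ((1 - \<omega>) * (X / (1 - \<omega>)) powr p + \<omega> * (Y / \<omega>) powr p)"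
      by (rule mult_left_mono) simp
    also have "\<dots> = X powr p + (1 / \<omega> - 1) powr (p - 1) * Y powr p"
    proof -
      have "1 / \<omega> - 1 = (1 - \<omega>) / \<omega>" using \<omega> by (simp add: field_simps)
      then show ?thesis using pos \<omega> by (simp add: powr_divide powr_diff field_simps)
    qed
    finally show ?thesis .
  qed
  moreover have "(1 - \<omega>) powr (p - 1) * norm a powr p \<le> (1 - \<omega>) powr (p - 1) * (X + Y) powr p"
    using tri p by (intro mult_left_mono powr_mono2) auto
  ultimately show ?thesis by (simp add: X_def Y_def)
qed

section \<open>Finiteness\<close>

text \<open>
Away from the unit sphere \<open>|z - \<eta>|\<close> is comparable to \<open>(1 + |z|\<^sup>2)\<^bsup>1/2\<^esup>\<close>.
\<close>

lemma unit_kernel_integral_finite_outside: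
  fixes \<eta> :: "real ^ 'm"
  assumes "norm \<eta> = 1" "real CARD('m) < s" "1 < \<rho>"
  shows "unit_kernel_integral s \<eta> (indicator {\<rho><..}) < \<infinity>"
proof -
  \<comment> \<open>The quotient \<open>(r + 1) / (r - 1)\<close> decreases in \<open>r\<close>, so on \<open>r > \<rho>\<close> it is at most \<open>C\<close>.\<close>
  define C where "C = (\<rho> + 1) / (\<rho> - 1)"
  have C: "0 < C" using assms by (simp add: C_def)
  have s: "0 < s" using assms by (smt (verit) of_nat_0_le_iff)
  have bound: "ennreal (norm (z - \<eta>) powr (- s)) * indicator {\<rho><..} (norm z)
      \<le> ennreal (C powr s) * ennreal ((1 + (norm z)\<^sup>2) powr (- (s / 2)))" for z
  proof (cases "\<rho> < norm z")
    case True
    have d: "norm z - 1 \<le> norm (z - \<eta>)" using norm_triangle_ineq2[of z \<eta>] assms by simp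
    have "1 + norm z \<le> C * (norm z - 1)"
      using True assms by (simp add: C_def field_simps)
    also have "\<dots> \<le> C * norm (z - \<eta>)" using C d by simp
    finally have le: "1 + norm z \<le> C * norm (z - \<eta>)" .
    have "1 + (norm z)\<^sup>2 \<le> (1 + norm z)\<^sup>2" by (simp add: power2_sum)
    also have "\<dots> \<le> (C * norm (z - \<eta>))\<^sup>2" using le by (intro power_mono) auto
    finally have "(1 + (norm z)\<^sup>2) powr (s / 2) \<le> ((C * norm (z - \<eta>))\<^sup>2) powr (s / 2)"
      using s by (intro powr_mono2) auto
    also have pos: "0 < norm (z - \<eta>)" using d True assms by linarith
    then have "((C * norm (z - \<eta>))\<^sup>2) powr (s / 2) = C powr s * norm (z - \<eta>) powr s"
      using C powr_realpow[of "C * norm (z - \<eta>)" 2] powr_powr[of "C * norm (z - \<eta>)" 2 "s / 2"]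
      by (simp add: powr_mult)
    finally have fin: "(1 + (norm z)\<^sup>2) powr (s / 2) \<le> C powr s * norm (z - \<eta>) powr s" .
    have "norm (z - \<eta>) powr (- s) \<le> C powr s * (1 + (norm z)\<^sup>2) powr (- (s / 2))"
    proof -
      have "0 < (1 + (norm z)\<^sup>2) powr (s / 2)" by (simp add: add_pos_nonneg less_imp_neq[THEN not_sym])
      moreover have "inverse Q \<le> D * inverse P" if "0 < P" "0 < Q" "P \<le> D * Q" for P Q D :: real
        using that by (simp add: field_simps)
      ultimately show ?thesis using pos fin by (simp add: powr_minus)
    qed
    then show ?thesis using True by (simp add: ennreal_mult' [symmetric])
  qed simp
  have "unit_kernel_integral s \<eta> (indicator {\<rho><..})
    \<le> (\<integral>\<^sup>+ (z :: real ^ 'm). ennreal (C powr s) * ennreal ((1 + (norm z)\<^sup>2) powr (- (s / 2))) \<partial>lborel)"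
    unfolding unit_kernel_integral_def by (rule nn_integral_mono) (rule bound)
  also have "\<dots> < \<infinity>"
    using assms nn_integral_one_plus_norm_powr[of "s / 2", where 'a = "real ^ 'm"]
    by (subst nn_integral_cmult) (auto simp: ennreal_mult_less_top)
  finally show ?thesis .
qed

text \<open>
Dyadic decomposition: for \<open>2\<^bsup>-k-1\<^esup> < |v| \<le> 2\<^bsup>-k\<^esup>\<close> the integrand is at most \<open>2\<^bsup>a(k+1)\<^esup>\<close>, while the ball
of radius \<open>2\<^bsup>-k\<^esup>\<close> has volume proportional to \<open>2\<^bsup>-kd\<^esup>\<close> in dimension \<open>d\<close>, so a geometric series of ratio
\<open>2\<^bsup>a-d\<^esup> < 1\<close> dominates the integral.
\<close>

lemma nn_integral_norm_powr_ball_finite: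
  assumes "0 < a" "a < real DIM('a)"
  shows "(\<integral>\<^sup>+ (v :: 'a::euclidean_space). ennreal (norm v powr (- a)) * indicator (cball 0 1) v \<partial>lborel) < \<infinity>"
proof -
  let ?r = "\<lambda>k::nat. (1 / 2 :: real) ^ k"
  have half: "?r k = 2 powr (- real k)" for k
    by (simp add: powr_minus powr_realpow power_one_over inverse_eq_divide)
  define V where "V = emeasure lborel (cball (0 :: 'a) 1)"
  have V: "V < \<infinity>" unfolding V_def by (rule emeasure_bounded_finite) simp
  have vol: "(\<integral>\<^sup>+ (v :: 'a). indicator (cball 0 (?r k)) v \<partial>lborel) = ennreal (?r k ^ DIM('a)) * V" for k
  proof -
    have [measurable]: "(indicator (cball 0 (?r k)) :: 'a \<Rightarrow> ennreal) \<in> borel_measurable borel" by (intro borel_measurable_indicator) simp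
    have "indicator (cball 0 (?r k)) (0 + ?r k *\<^sub>R v) = (indicator (cball 0 1) v :: ennreal)" for v :: 'a
      by (simp add: indicator_def)
    then show ?thesis
      using nn_integral_lborel_affine[of "indicator (cball (0 :: 'a) (?r k))" "?r k" 0] by (simp add: V_def)
  qed
  define q where "q = 2 powr (a - real DIM('a))"
  have q: "0 < q" "q < 1" using assms powr_less_mono[of "a - real DIM('a)" 0 2] by (simp_all add: q_def)
  have "(\<integral>\<^sup>+ (v :: 'a). ennreal (norm v powr (- a)) * indicator (cball 0 1) v \<partial>lborel)
    \<le> (\<integral>\<^sup>+ (v :: 'a). (\<Sum>k. ennreal (2 powr (a * (real k + 1))) * indicator (cball 0 (?r k)) v) \<partial>lborel)"
  proof (rule nn_integral_mono)
    fix v :: 'a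
    let ?g = "\<lambda>k. ennreal (2 powr (a * (real k + 1))) * indicator (cball 0 (?r k)) v"
    show "ennreal (norm v powr (- a)) * indicator (cball 0 1) v \<le> (\<Sum>k. ?g k)"
    proof (cases "v \<noteq> 0 \<and> norm v \<le> 1")
      case True
      obtain j where "?r j < norm v"
        using True real_arch_pow_inv[of "norm v" "1/2"] by auto
      then have ex: "?r (LEAST j. ?r j < norm v) < norm v" by (rule LeastI)
      define j0 where "j0 = (LEAST j. ?r j < norm v)"
      have "j0 \<noteq> 0" using ex True unfolding j0_def [symmetric] by (intro notI) simp
      then obtain k where k: "j0 = Suc k" by (cases j0) auto
      have "\<not> ?r k < norm v" using k not_less_Least[of k "\<lambda>j. ?r j < norm v"] by (simp add: j0_def)
      moreover have "?r (Suc k) < norm v" using ex k by (simp add: j0_def)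
      ultimately have kk: "norm v \<le> ?r k" "?r (Suc k) < norm v" by simp_all
      have "norm v powr (- a) \<le> ?r (Suc k) powr (- a)"
        using kk assms by (intro powr_mono2') auto
      also have "?r (Suc k) = 2 powr (- real (Suc k))" by (rule half)
      also have "\<dots> powr (- a) = 2 powr (a * (real k + 1))" by (simp only: powr_powr) (simp add: algebra_simps)
      finally have "ennreal (norm v powr (- a)) * indicator (cball 0 1) v \<le> ?g k"
        using kk True by (simp add: indicator_def)
      also have "\<dots> = sum ?g {k}"
        by (simp only: sum.insert finite.emptyI empty_iff not_False_eq_True sum.empty add_0_right)
      also have "\<dots> \<le> (\<Sum>k. ?g k)" by (rule sum_le_suminf) auto
      finally show ?thesis .
    qed auto
  qed
  also have "\<dots> = (\<Sum>k. ennreal (2 powr (a * (real k + 1))) * (ennreal (?r k ^ DIM('a)) * V))"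
  proof (subst nn_integral_suminf)
    have ind: "(indicator (cball 0 (?r k)) :: 'a \<Rightarrow> ennreal) \<in> borel_measurable lborel" for k
      by (intro borel_measurable_indicator) simp
    then show "(\<lambda>v::'a. ennreal (2 powr (a * (real k + 1))) * indicator (cball 0 (?r k)) v) \<in> borel_measurable lborel" for k
      by (intro borel_measurable_times_ennreal) auto
    show "(\<Sum>k. \<integral>\<^sup>+ (v :: 'a). ennreal (2 powr (a * (real k + 1))) * indicator (cball 0 (?r k)) v \<partial>lborel)
      = (\<Sum>k. ennreal (2 powr (a * (real k + 1))) * (ennreal (?r k ^ DIM('a)) * V))"
      unfolding nn_integral_cmult[OF ind] vol ..
  qed
  also have "\<dots> = (\<Sum>k. ennreal (q ^ k) * (ennreal (2 powr a) * V))"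
  proof (rule suminf_cong)
    fix k
    have "2 powr (a * (real k + 1)) * ?r k ^ DIM('a) = q ^ k * 2 powr a"
    proof -
      have "q ^ k = 2 powr ((a - real DIM('a)) * real k)"
        using q powr_realpow[of q k] powr_powr[of 2 "a - real DIM('a)" "real k"] by (simp only: q_def)
      moreover have "?r k ^ DIM('a) = 2 powr (- real k * real DIM('a))"
        unfolding half using powr_realpow[of "2 powr (- real k)" "DIM('a)"]
        by (simp add: powr_powr)
      moreover have "a * (real k + 1) + - real k * real DIM('a) = (a - real DIM('a)) * real k + a"
        by (simp add: algebra_simps)
      ultimately show ?thesis by (simp only: powr_add [symmetric])
    qed
    then show "ennreal (2 powr (a * (real k + 1))) * (ennreal (?r k ^ DIM('a)) * V)
      = ennreal (q ^ k) * (ennreal (2 powr a) * V)"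
      using q by (simp add: mult.assoc [symmetric] ennreal_mult' [symmetric])
  qed
  also have "\<dots> = (\<Sum>k. ennreal (q ^ k)) * (ennreal (2 powr a) * V)" by simp
  also have "(\<Sum>k. ennreal (q ^ k)) = ennreal (\<Sum>k. q ^ k)"
    using q by (intro suminf_ennreal2 summable_geometric) auto
  also have "ennreal (\<Sum>k. q ^ k) * (ennreal (2 powr a) * V) < \<infinity>"
    using V by (simp add: ennreal_mult_less_top)
  finally show ?thesis .
qed

lemma nn_integral_weighted_decay_finite:
  assumes "0 < a" "a < real DIM('a)" "real DIM('a) / 2 < q"
  shows "(\<integral>\<^sup>+ (v :: 'a::euclidean_space). ennreal (norm v powr (- a) * (1 + (norm v)\<^sup>2) powr (- q)) \<partial>lborel) < \<infinity>"
proof -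
  have q: "0 < q" using assms(3) by (rule le_less_trans[rotated]) simp
  have "(\<integral>\<^sup>+ (v :: 'a). ennreal (norm v powr (- a) * (1 + (norm v)\<^sup>2) powr (- q)) \<partial>lborel)
    \<le> (\<integral>\<^sup>+ (v :: 'a). ennreal (norm v powr (- a)) * indicator (cball 0 1) v
         + ennreal ((1 + (norm v)\<^sup>2) powr (- q)) \<partial>lborel)"
  proof (rule nn_integral_mono)
    fix v :: 'a
    show "ennreal (norm v powr (- a) * (1 + (norm v)\<^sup>2) powr (- q))
      \<le> ennreal (norm v powr (- a)) * indicator (cball 0 1) v + ennreal ((1 + (norm v)\<^sup>2) powr (- q))"
    proof (cases "norm v \<le> 1")
      case True
      have "(1 + (norm v)\<^sup>2) powr (- q) \<le> 1 powr (- q)" using q by (intro powr_mono2') auto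
      then have "norm v powr (- a) * (1 + (norm v)\<^sup>2) powr (- q) \<le> norm v powr (- a)"
        by (intro mult_left_le) auto
      then show ?thesis using True by (simp add: add_increasing2 ennreal_leI)
    next
      case False
      then have "norm v powr (- a) \<le> 1 powr (- a)" using assms by (intro powr_mono2') auto
      then have "norm v powr (- a) * (1 + (norm v)\<^sup>2) powr (- q) \<le> (1 + (norm v)\<^sup>2) powr (- q)"
        by (intro mult_left_le_one_le) auto
      then show ?thesis using False by (simp add: ennreal_leI)
    qed
  qed
  also have "\<dots> < \<infinity>"
    using nn_integral_norm_powr_ball_finite[OF assms(1,2)] nn_integral_one_plus_norm_powr[OF assms(3)]
    by (subst nn_integral_add) (auto intro!: borel_measurable_times_ennreal borel_measurable_indicator)
  finally show ?thesis .
qed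

lemma schwartz_borel_measurable:
  assumes "schwartz f"
  shows "f \<in> borel_measurable borel"
proof -
  have "f differentiable (at x)" for x
    using assms unfolding schwartz_def by (metis iter_partial_deriv.simps(1) empty_subsetI list.set(1))
  then show ?thesis
    by (intro borel_measurable_continuous_onI continuous_at_imp_continuous_on)
       (simp add: differentiable_imp_continuous_within)
qed

lemma schwartz_decay:
  assumes "schwartz f"
  obtains C where "0 < C" "\<And>w. norm (f w) \<le> C * (1 + (norm w)\<^sup>2) powr (- real j)"
proof -
  have "\<forall>k. \<exists>C. \<forall>x. norm x ^ k * norm (f x) \<le> C"
    using assms unfolding schwartz_def by (metis iter_partial_deriv.simps(1) empty_subsetI list.set(1))
  then obtain C0 C1 where C0: "norm w ^ 0 * norm (f w) \<le> C0" and C1: "norm w ^ (2 * j) * norm (f w) \<le> C1" for w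
    by metis
  define C where "C = 2 ^ j * (\<bar>C0\<bar> + \<bar>C1\<bar> + 1)"
  have "norm (f w) \<le> C * (1 + (norm w)\<^sup>2) powr (- real j)" for w
  proof -
    have "(1 + (norm w)\<^sup>2) ^ j \<le> 2 ^ j * (1 + norm w ^ (2 * j))"
    proof (cases "norm w \<le> 1")
      case True
      then have "1 + (norm w)\<^sup>2 \<le> 2" by (simp add: power_le_one)
      then have "(1 + (norm w)\<^sup>2) ^ j \<le> 2 ^ j" by (intro power_mono) auto
      also have "\<dots> \<le> 2 ^ j * (1 + norm w ^ (2 * j))" by simp
      finally show ?thesis .
    next
      case False
      then have "1 + (norm w)\<^sup>2 \<le> 2 * (norm w)\<^sup>2" by (simp add: one_le_power)
      then have "(1 + (norm w)\<^sup>2) ^ j \<le> (2 * (norm w)\<^sup>2) ^ j" by (intro power_mono) auto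
      also have "\<dots> = 2 ^ j * norm w ^ (2 * j)" by (simp add: power_mult_distrib power_mult)
      also have "\<dots> \<le> 2 ^ j * (1 + norm w ^ (2 * j))" by simp
      finally show ?thesis .
    qed
    then have "(1 + (norm w)\<^sup>2) ^ j * norm (f w) \<le> 2 ^ j * (1 + norm w ^ (2 * j)) * norm (f w)"
      by (rule mult_right_mono) simp
    also have "\<dots> = 2 ^ j * (norm (f w) + norm w ^ (2 * j) * norm (f w))" by (simp add: algebra_simps)
    also have "\<dots> \<le> C" unfolding C_def using C0[of w] C1[of w] by (intro mult_left_mono) auto
    finally have "(1 + (norm w)\<^sup>2) ^ j * norm (f w) \<le> C" .
    then show ?thesis
      by (simp add: powr_minus powr_realpow add_pos_nonneg field_simps)
  qed
  moreover have "0 < C" by (simp add: C_def add_nonneg_pos)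
  ultimately show thesis by (rule that[rotated])
qed

text \<open>
The two variables are separated by \<open>(1 + |x|\<^sup>2) (1 + |v|\<^sup>2) \<le> (1 + |w|\<^sup>2)\<^sup>2\<close>. Finiteness of this
integral is what allows equal terms to be cancelled in the truncated inequality.
\<close>

lemma schwartz_weighted_norm_finite:
  fixes f :: "('a::euclidean_space) \<times> ('b::euclidean_space) \<Rightarrow> complex"
  assumes f: "schwartz f" and p: "1 \<le> p" and a: "0 < a" "a < real DIM('b)"
  shows "(\<integral>\<^sup>+ w. ennreal (norm (snd w) powr (- a) * norm (f w) powr p) \<partial>lborel) < \<infinity>"
proof -
  define j where "j = DIM('a) + DIM('b)"
  define q where "q = real j / 2"
  have q: "real DIM('a) / 2 < q" "real DIM('b) / 2 < q" by (auto simp: q_def j_def)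
  then have q0: "0 < q" by (smt (verit) of_nat_0_le_iff divide_nonneg_pos)
  obtain C where C: "0 < C" "\<And>w. norm (f w) \<le> C * (1 + (norm w)\<^sup>2) powr (- real j)"
    using schwartz_decay[OF f, of j] by blast
  let ?X = "\<lambda>x::'a. (1 + (norm x)\<^sup>2) powr (- q)"
  let ?Y = "\<lambda>v::'b. norm v powr (- a) * (1 + (norm v)\<^sup>2) powr (- q)"
  have bound: "norm v powr (- a) * norm (f (x, v)) powr p \<le> C powr p * ?X x * ?Y v" for x v
  proof -
    let ?t = "1 + (norm (x, v))\<^sup>2"
    have t: "1 \<le> ?t" by simp
    have "norm (f (x, v)) powr p \<le> (C * ?t powr (- real j)) powr p"
      using C p by (intro powr_mono2) auto
    also have "\<dots> = C powr p * ?t powr (- (real j * p))"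
      using C t by (simp add: powr_mult powr_powr)
    also have "?t powr (- (real j * p)) \<le> ?t powr (- (2 * q))"
      using t p by (intro powr_mono) (auto simp: q_def mult_le_cancel_left1)
    also have "?t powr (- (2 * q)) = (?t\<^sup>2) powr (- q)"
      using t powr_realpow[of ?t 2] powr_powr[of ?t 2 "- q"] by simp
    also have "\<dots> \<le> ((1 + (norm x)\<^sup>2) * (1 + (norm v)\<^sup>2)) powr (- q)"
    proof (rule powr_mono2')
      have "(norm (x, v))\<^sup>2 = (norm x)\<^sup>2 + (norm v)\<^sup>2" by (simp add: norm_Pair)
      then have "?t\<^sup>2 = ((1 + (norm x)\<^sup>2) + (norm v)\<^sup>2)\<^sup>2" by simp
      also have "\<dots> = (1 + (norm x)\<^sup>2) * (1 + (norm v)\<^sup>2) + ((norm x)\<^sup>2 + (norm x)\<^sup>2 * (norm x)\<^sup>2 + (norm v)\<^sup>2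
         + (norm v)\<^sup>2 * (norm v)\<^sup>2 + (norm x)\<^sup>2 * (norm v)\<^sup>2)"
        by (simp add: power2_eq_square algebra_simps)
      finally show "(1 + (norm x)\<^sup>2) * (1 + (norm v)\<^sup>2) \<le> ?t\<^sup>2" by simp
    qed (use q0 in \<open>auto intro!: mult_pos_pos add_pos_nonneg\<close>)
    also have "\<dots> = ?X x * (1 + (norm v)\<^sup>2) powr (- q)"
      by (simp add: powr_mult add_nonneg_nonneg)
    finally have "norm (f (x, v)) powr p \<le> C powr p * (?X x * (1 + (norm v)\<^sup>2) powr (- q))"
      by (simp add: mult_left_mono)
    then have "norm v powr (- a) * norm (f (x, v)) powr p
        \<le> norm v powr (- a) * (C powr p * (?X x * (1 + (norm v)\<^sup>2) powr (- q)))"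
      by (rule mult_left_mono) simp
    then show ?thesis by (simp add: mult_ac)
  qed
  have [measurable]: "f \<in> borel_measurable borel" using f by (rule schwartz_borel_measurable)
  have [measurable]: "(snd :: 'a \<times> 'b \<Rightarrow> _) \<in> borel_measurable borel"
    by (intro borel_measurable_continuous_onI continuous_intros)
  have meas: "(\<lambda>w. ennreal (norm (snd w) powr (- a) * norm (f w) powr p)) \<in> borel_measurable lborel"
    by measurable
  have "(\<integral>\<^sup>+ w. ennreal (norm (snd w) powr (- a) * norm (f w) powr p) \<partial>lborel)
    = (\<integral>\<^sup>+ w. ennreal (norm (snd w) powr (- a) * norm (f w) powr p) \<partial>(lborel \<Otimes>\<^sub>M lborel))"
    by (simp add: lborel_prod)
  also have "\<dots> = (\<integral>\<^sup>+ x. \<integral>\<^sup>+ v. ennreal (norm v powr (- a) * norm (f (x, v)) powr p) \<partial>lborel \<partial>lborel)"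
    using meas by (subst lborel.nn_integral_fst [symmetric]) (simp_all add: lborel_prod)
  also have "\<dots> \<le> (\<integral>\<^sup>+ x. \<integral>\<^sup>+ v. ennreal (C powr p) * ennreal (?X x) * ennreal (?Y v) \<partial>lborel \<partial>lborel)"
    using bound by (intro nn_integral_mono) (simp add: ennreal_mult' [symmetric] ennreal_leI)
  also have "\<dots> = ennreal (C powr p) * (\<integral>\<^sup>+ x. ennreal (?X x) \<partial>lborel) * (\<integral>\<^sup>+ v. ennreal (?Y v) \<partial>lborel)"
    by (simp add: nn_integral_cmult nn_integral_multc)
  also have "\<dots> < \<infinity>"
    using nn_integral_weighted_decay_finite[OF a q(2)] nn_integral_one_plus_norm_powr[OF q(1)]
    by (auto simp: ennreal_mult_less_top)
  finally show ?thesis .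
qed

section \<open>The Hardy inequality\<close>

lemma hardy_const_eq:
  fixes \<eta> :: "real ^ 'm"
  shows "hardy_const n p \<beta> \<eta> =
    ennreal (pi powr (real n / 2) * Gamma ((real CARD('m) + p * \<beta>) / 2)
      / Gamma ((real n + (real CARD('m) + p * \<beta>)) / 2)) *
    unit_kernel_integral (real CARD('m) + p * \<beta>) \<eta>
      (\<lambda>r. ennreal (\<bar>1 - r powr (- ((real CARD('m) - p * \<beta>) / p))\<bar> powr p))"
  by (simp add: hardy_const_def unit_kernel_integral_def Let_def ennreal_mult' mult.commute add.assoc)

text \<open>
Inversion maps the part \<open>|z| < 1\<close> of the integral onto the part \<open>|z| > 1\<close>, because the factor
\<open>r\<^bsup>s-2m\<^esup>\<close> is the \<open>p\<close>-th power of \<open>r\<^bsup>-\<mu>\<^esup>\<close> and \<open>r\<^bsup>-\<mu>\<^esup> (r\<^bsup>\<mu>\<^esup> - 1) = 1 - r\<^bsup>-\<mu>\<^esup>\<close>. The constant can thus be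
compared with an energy over one ordering of the norms only.
\<close>

lemma unit_kernel_integral_ratio_powr:
  fixes \<eta> :: "real ^ 'm"
  assumes \<eta>: "norm \<eta> = 1" and \<mu>: "0 < \<mu>" "\<mu> * p = 2 * real CARD('m) - s"
  shows "unit_kernel_integral s \<eta> (\<lambda>r. ennreal (\<bar>1 - r powr (- \<mu>)\<bar> powr p))
    = 2 * unit_kernel_integral s \<eta> (\<lambda>r. ennreal (indicator {1<..} r * (1 - r powr (- \<mu>)) powr p))"
proof -
  let ?G = "\<lambda>r. ennreal (\<bar>1 - r powr (- \<mu>)\<bar> powr p)"
  let ?in = "\<lambda>r. ennreal (indicator {0<..<1} r * \<bar>1 - r powr (- \<mu>)\<bar> powr p)"
  let ?out = "\<lambda>r. ennreal (indicator {1<..} r * (1 - r powr (- \<mu>)) powr p)"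
  have ne0: "AE z in lborel. z \<noteq> (0 :: real ^ 'm)" by (rule AE_lborel_singleton)
  have split: "?G r = ?in r + ?out r" if "0 < r" for r :: real
  proof -
    consider "r < 1" | "r = 1" | "1 < r" by linarith
    then show ?thesis
    proof cases
      case 3
      then have "r powr (- \<mu>) \<le> 1" using \<mu> powr_mono2'[of "- \<mu>" 1 r] by simp
      then show ?thesis using 3 by simp
    qed (use that in auto)
  qed
  have inv: "ennreal (r powr (s - 2 * real CARD('m))) * ?in (1 / r) = ?out r" if r: "0 < r" for r :: real
  proof (cases "1 < r")
    case True
    have lt: "r powr (- \<mu>) < 1" using \<mu> True powr_less_mono[of "- \<mu>" 0 r] by simp
    have "1 \<le> r powr \<mu>" using True \<mu> by (simp add: ge_one_powr_ge_zero)
    moreover have "(1 / r) powr (- \<mu>) = r powr \<mu>" using r by (simp add: powr_divide powr_minus)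
    ultimately have "\<bar>1 - (1 / r) powr (- \<mu>)\<bar> = r powr \<mu> - 1" by simp
    moreover have "r powr (s - 2 * real CARD('m)) = (r powr (- \<mu>)) powr p"
      using \<mu> by (simp add: powr_powr)
    ultimately have "r powr (s - 2 * real CARD('m)) * \<bar>1 - (1 / r) powr (- \<mu>)\<bar> powr p
        = (r powr (- \<mu>) * (r powr \<mu> - 1)) powr p"
      using \<open>1 \<le> r powr \<mu>\<close> by (simp add: powr_mult)
    also have "r powr (- \<mu>) * (r powr \<mu> - 1) = 1 - r powr (- \<mu>)"
      using r by (simp add: powr_minus field_simps)
    finally show ?thesis using True by (simp add: ennreal_mult' [symmetric])
  qed (use r in \<open>auto simp: indicator_def field_simps\<close>)
  have "unit_kernel_integral s \<eta> ?G = unit_kernel_integral s \<eta> ?in + unit_kernel_integral s \<eta> ?out"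
    unfolding unit_kernel_integral_def
  proof (subst nn_integral_add [symmetric])
    show "(\<integral>\<^sup>+ z. ennreal (norm (z - \<eta>) powr (- s)) * ?G (norm z) \<partial>lborel)
      = (\<integral>\<^sup>+ z. ennreal (norm (z - \<eta>) powr (- s)) * ?in (norm z)
          + ennreal (norm (z - \<eta>) powr (- s)) * ?out (norm z) \<partial>lborel)"
      by (intro nn_integral_cong_AE, use ne0 in eventually_elim) (simp add: split distrib_left)
  qed measurable
  also have "unit_kernel_integral s \<eta> ?in = unit_kernel_integral s \<eta> (\<lambda>r. ennreal (r powr (s - 2 * real CARD('m))) * ?in (1 / r))"
    using \<eta> by (intro unit_kernel_integral_inversion) measurable
  also have "\<dots> = unit_kernel_integral s \<eta> ?out"
    unfolding unit_kernel_integral_def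
    by (intro nn_integral_cong_AE, use ne0 in eventually_elim) (simp add: inv)
  finally show ?thesis by (simp add: mult_2)
qed

text \<open>
The setting of the proof. Here \<open>a\<close> plays the role of \<open>p\<beta>\<close>, \<open>|v|\<^bsup>-\<mu>\<^esup>\<close> is the virtual ground state,
\<open>K\<close> the full kernel on pairs, \<open>N\<close> the weighted norm on the right-hand side of the inequality, and
\<open>c\<close> the factor gained by integrating out the unweighted variable.
\<close>

context
  fixes f :: "('a::euclidean_space) \<times> (real ^ 'm) \<Rightarrow> complex"
    and p a s \<mu> :: real and \<eta> :: "real ^ 'm"
    and K :: "'a \<times> (real ^ 'm) \<Rightarrow> 'a \<times> (real ^ 'm) \<Rightarrow> ennreal"
    and N c :: ennreal
  assumes f_meas [measurable]: "f \<in> borel_measurable borel"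
    and p: "1 \<le> p" and a: "0 < a" "a < real CARD('m)" and \<eta>: "norm \<eta> = 1"
  defines "s \<equiv> real CARD('m) + a"
    and "\<mu> \<equiv> (real CARD('m) - a) / p"
    and "K \<equiv> \<lambda>w w'. ennreal (1 / norm (w - w') powr (real DIM('a) + s))"
    and "N \<equiv> (\<integral>\<^sup>+ w. ennreal (norm (snd w) powr (- a) * norm (f w) powr p) \<partial>lborel)"
    and "c \<equiv> ennreal (pi powr (real DIM('a) / 2) * Gamma (s / 2) / Gamma ((real DIM('a) + s) / 2))"
  assumes N_finite: "N < \<infinity>"
begin

lemma \<mu>_pos: "0 < \<mu>" using a p by (simp add: \<mu>_def)

lemma \<mu>_times_p: "\<mu> * p = 2 * real CARD('m) - s" using p by (simp add: \<mu>_def s_def)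

lemma s_pos: "0 < s" using a by (simp add: s_def add_nonneg_pos)

lemma K_commute: "K w w' = K w' w" by (simp add: K_def norm_minus_commute)

lemma K_measurable [measurable]:
  "(\<lambda>z. K (fst z) (snd z)) \<in> borel_measurable (lborel \<Otimes>\<^sub>M lborel)"
  "(\<lambda>w'. K w w') \<in> borel_measurable lborel"
  "(\<lambda>w'. K w' w) \<in> borel_measurable lborel"
  unfolding K_def by measurable

lemma norm_snd_measurable [measurable]:
  "(\<lambda>w. norm (snd w)) \<in> borel_measurable (borel :: ('a \<times> (real ^ 'm)) measure)"
  by (intro borel_measurable_continuous_onI continuous_intros)

lemma AE_snd_nonzero: "AE w in lborel. snd (w :: 'a \<times> (real ^ 'm)) \<noteq> 0"
proof -
  have "AE w in (lborel :: 'a measure) \<Otimes>\<^sub>M (lborel :: (real ^ 'm) measure). snd w \<noteq> 0"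
  proof (rule lborel_pair.AE_pair_measure)
    have "{w \<in> space (lborel \<Otimes>\<^sub>M lborel). snd w \<noteq> 0} = (space lborel :: 'a set) \<times> (- {0 :: real ^ 'm})"
      by (auto simp: space_pair_measure)
    also have "\<dots> \<in> sets (lborel \<Otimes>\<^sub>M lborel)" by (intro pair_measureI) auto
    finally show "{w \<in> space (lborel \<Otimes>\<^sub>M lborel). snd w \<noteq> (0 :: real ^ 'm)} \<in> sets ((lborel :: 'a measure) \<Otimes>\<^sub>M lborel)" .
    show "AE x in (lborel :: 'a measure). AE y in lborel. snd (x, y) \<noteq> (0 :: real ^ 'm)"
      by (simp add: AE_lborel_singleton)
  qed
  then show ?thesis unfolding lborel_prod .
qed

lemma nn_integral_kernel_weight:
  assumes [measurable]: "H \<in> borel_measurable borel"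
  shows "(\<integral>\<^sup>+ w. \<integral>\<^sup>+ w'. K w w' * H (norm (snd w') / norm (snd w)) * ennreal (norm (f w) powr p) \<partial>lborel \<partial>lborel)
    = c * unit_kernel_integral s \<eta> H * N"
proof -
  have "(\<integral>\<^sup>+ w. \<integral>\<^sup>+ w'. K w w' * H (norm (snd w') / norm (snd w)) * ennreal (norm (f w) powr p) \<partial>lborel \<partial>lborel)
    = (\<integral>\<^sup>+ w. c * unit_kernel_integral s \<eta> H * ennreal (norm (snd w) powr (- a) * norm (f w) powr p) \<partial>lborel)"
  proof (intro nn_integral_cong_AE, use AE_snd_nonzero in eventually_elim)
    fix w :: "'a \<times> (real ^ 'm)" assume w: "snd w \<noteq> 0"
    have "(\<integral>\<^sup>+ w'. K w w' * H (norm (snd w') / norm (snd w)) * ennreal (norm (f w) powr p) \<partial>lborel)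
      = (\<integral>\<^sup>+ w'. K w w' * H (norm (snd w') / norm (snd w)) \<partial>lborel) * ennreal (norm (f w) powr p)"
      by (rule nn_integral_multc) measurable
    also have "(\<integral>\<^sup>+ w'. K w w' * H (norm (snd w') / norm (snd w)) \<partial>lborel)
      = c * unit_kernel_integral s \<eta> H * ennreal (norm (snd w) powr (- a))"
      using nn_integral_product_kernel[OF assms \<eta> w s_pos, of "fst w"]
      by (simp add: K_def c_def s_def)
    finally show "(\<integral>\<^sup>+ w'. K w w' * H (norm (snd w') / norm (snd w)) * ennreal (norm (f w) powr p) \<partial>lborel)
      = c * unit_kernel_integral s \<eta> H * ennreal (norm (snd w) powr (- a) * norm (f w) powr p)"
      by (simp add: ennreal_mult mult.assoc)
  qed
  also have "\<dots> = c * unit_kernel_integral s \<eta> H * N"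
    unfolding N_def by (rule nn_integral_cmult) measurable
  finally show ?thesis .
qed

text \<open>
The pointwise inequality is used with \<open>a = f w\<close>, \<open>b = f w'\<close> and \<open>\<omega> = r\<^bsup>-\<mu>\<^esup>\<close>, where
\<open>r = |v'| / |v|\<close>, and integrated against \<open>K\<close> over \<open>r > \<rho>\<close>. Both terms without a difference become
multiples of \<open>N\<close>: the one with \<open>f w\<close> by integrating over \<open>w'\<close>, the one with \<open>f w'\<close> by integrating
over \<open>w\<close>, which sees the reciprocal ratio and is brought back to \<open>r > \<rho>\<close> by inversion. The weights are
then \<open>(1 - \<omega>)\<^bsup>p-1\<^esup>\<close> and \<open>\<omega> (1 - \<omega>)\<^bsup>p-1\<^esup>\<close>, and their difference is \<open>(1 - \<omega>)\<^bsup>p\<^esup>\<close>. The truncation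
\<open>\<rho> > 1\<close> keeps both integrals finite, which the subtraction requires.
\<close>

lemma truncated_energy_ge:
  assumes \<rho>: "1 < \<rho>"
  shows "c * unit_kernel_integral s \<eta> (\<lambda>r. ennreal (indicator {\<rho><..} r * (1 - r powr (- \<mu>)) powr p)) * N
    \<le> (\<integral>\<^sup>+ w. \<integral>\<^sup>+ w'. K w w' * ennreal (norm (f w - f w') powr p)
          * indicator {\<rho><..} (norm (snd w') / norm (snd w)) \<partial>lborel \<partial>lborel)"
    (is "c * unit_kernel_integral s \<eta> ?P * N \<le> ?D")
proof -
  define A where "A r = ennreal (indicator {\<rho><..} r * (1 - r powr (- \<mu>)) powr (p - 1))" for r :: real
  define B where "B r = ennreal (indicator {\<rho><..} r * (r powr \<mu> - 1) powr (p - 1))" for r :: real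
  \<comment> \<open>\<open>B'\<close> is the weight \<open>B\<close> as a function of \<open>|v| / |v'|\<close>, the ratio seen when \<open>v'\<close> is held fixed.\<close>
  define B' where "B' q = B (1 / q)" for q :: real
  \<comment> \<open>\<open>Q\<close> is the image of \<open>B'\<close> under inversion, with \<open>s - 2 m = - \<mu> p\<close>.\<close>
  define Q where "Q r = ennreal (r powr (- (\<mu> * p))) * B r" for r :: real
  have [measurable]: "A \<in> borel_measurable borel" "B \<in> borel_measurable borel"
    "B' \<in> borel_measurable borel" "Q \<in> borel_measurable borel"
    unfolding A_def B'_def Q_def B_def by measurable
  have small: "0 < r powr (- \<mu>)" "r powr (- \<mu>) < 1" "1 / r powr (- \<mu>) = r powr \<mu>" if "\<rho> < r" for r
  proof -
    have "1 < r" using that \<rho> by simp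
    then have "1 < r powr \<mu>" using \<mu>_pos by simp
    then show "0 < r powr (- \<mu>)" "r powr (- \<mu>) < 1" "1 / r powr (- \<mu>) = r powr \<mu>"
      using \<open>1 < r\<close> by (simp_all add: powr_minus inverse_less_1_iff inverse_eq_divide)
  qed
  have Q_eq: "Q r = ennreal (indicator {\<rho><..} r * (r powr (- \<mu>) * (1 - r powr (- \<mu>)) powr (p - 1)))" for r
  proof (cases "\<rho> < r")
    case True
    define \<omega> where "\<omega> = r powr (- \<mu>)"
    have \<omega>: "0 < \<omega>" "\<omega> < 1" "r powr \<mu> = 1 / \<omega>" using small[OF True] by (simp_all add: \<omega>_def)
    have "r powr (- (\<mu> * p)) = \<omega> powr p" by (simp add: \<omega>_def powr_powr)
    moreover have "\<omega> powr p * (1 / \<omega> - 1) powr (p - 1) = \<omega> * (\<omega> * (1 / \<omega> - 1)) powr (p - 1)"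
      using \<omega> by (simp add: powr_mult powr_diff)
    moreover have "\<omega> * (1 / \<omega> - 1) = 1 - \<omega>" using \<omega> by (simp add: field_simps)
    ultimately show ?thesis using True \<omega> by (simp add: Q_def B_def ennreal_mult' [symmetric] \<omega>_def [symmetric])
  qed (simp add: Q_def B_def)
  have A_split: "A r = Q r + ?P r" for r
  proof (cases "\<rho> < r")
    case True
    define \<omega> where "\<omega> = r powr (- \<mu>)"
    have \<omega>: "0 < \<omega>" "\<omega> < 1" using small[OF True] by (simp_all add: \<omega>_def)
    have "(1 - \<omega>) powr p = (1 - \<omega>) * (1 - \<omega>) powr (p - 1)" using \<omega> by (simp add: powr_diff)
    then have "(1 - \<omega>) powr (p - 1) = \<omega> * (1 - \<omega>) powr (p - 1) + (1 - \<omega>) powr p"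
      by (simp add: algebra_simps)
    then show ?thesis using True \<omega>
      by (simp add: A_def Q_eq \<omega>_def [symmetric] ennreal_plus [symmetric] del: ennreal_plus)
  qed (simp add: A_def Q_eq)
  have A_int: "unit_kernel_integral s \<eta> A = unit_kernel_integral s \<eta> Q + unit_kernel_integral s \<eta> ?P"
    unfolding unit_kernel_integral_def A_split distrib_left by (rule nn_integral_add) measurable
  have "Q r \<le> indicator {\<rho><..} r" for r
  proof (cases "\<rho> < r")
    case True
    have "r powr (- \<mu>) * (1 - r powr (- \<mu>)) powr (p - 1) \<le> 1 * 1 powr (p - 1)"
      using small[OF True] p by (intro mult_mono powr_mono2) auto
    then show ?thesis using True by (simp add: Q_eq)
  qed (simp add: Q_eq)
  then have "unit_kernel_integral s \<eta> Q \<le> unit_kernel_integral s \<eta> (indicator {\<rho><..})"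
    unfolding unit_kernel_integral_def by (intro nn_integral_mono mult_left_mono) auto
  also have "\<dots> < \<infinity>" using \<eta> a \<rho> by (intro unit_kernel_integral_finite_outside) (auto simp: s_def)
  finally have Q_fin: "unit_kernel_integral s \<eta> Q < \<infinity>" .
  have Q_inv: "unit_kernel_integral s \<eta> B' = unit_kernel_integral s \<eta> Q"
  proof -
    have "s - 2 * real CARD('m) = - (\<mu> * p)" using \<mu>_times_p by simp
    then show ?thesis
      using unit_kernel_integral_inversion[of B' \<eta> s] \<eta> by (simp add: B'_def Q_def [abs_def])
  qed
  let ?r = "\<lambda>w w'. norm (snd w') / norm (snd w)"
  have pointwise: "K w w' * A (?r w w') * ennreal (norm (f w) powr p)
    \<le> K w w' * ennreal (norm (f w - f w') powr p) * indicator {\<rho><..} (?r w w')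
      + K w w' * B (?r w w') * ennreal (norm (f w') powr p)" for w w'
  proof (cases "\<rho> < ?r w w'")
    case True
    define R where "R = ?r w w'"
    have R: "\<rho> < R" using True by (simp add: R_def)
    have "(1 - R powr (- \<mu>)) powr (p - 1) * norm (f w) powr p
      \<le> norm (f w - f w') powr p + (R powr \<mu> - 1) powr (p - 1) * norm (f w') powr p"
      using powr_norm_diff_ge[OF p small(1,2)[OF R], of "f w" "f w'"] by (simp add: small(3)[OF R])
    then have "A R * ennreal (norm (f w) powr p)
      \<le> ennreal (norm (f w - f w') powr p) + B R * ennreal (norm (f w') powr p)"
      using R by (simp add: A_def B_def ennreal_mult' [symmetric] ennreal_plus [symmetric] ennreal_leI del: ennreal_plus)
    then have "K w w' * (A R * ennreal (norm (f w) powr p))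
      \<le> K w w' * (ennreal (norm (f w - f w') powr p) + B R * ennreal (norm (f w') powr p))"
      by (rule mult_left_mono) simp
    then show ?thesis using True by (simp add: R_def distrib_left mult.assoc)
  qed (simp add: A_def)
  have "c * unit_kernel_integral s \<eta> A * N
    = (\<integral>\<^sup>+ w. \<integral>\<^sup>+ w'. K w w' * A (?r w w') * ennreal (norm (f w) powr p) \<partial>lborel \<partial>lborel)"
    by (rule nn_integral_kernel_weight [symmetric]) measurable
  also have "\<dots> \<le> (\<integral>\<^sup>+ w. \<integral>\<^sup>+ w'. K w w' * ennreal (norm (f w - f w') powr p) * indicator {\<rho><..} (?r w w')
      + K w w' * B (?r w w') * ennreal (norm (f w') powr p) \<partial>lborel \<partial>lborel)"
    by (intro nn_integral_mono pointwise)
  also have "\<dots> = ?D + (\<integral>\<^sup>+ w. \<integral>\<^sup>+ w'. K w w' * B (?r w w') * ennreal (norm (f w') powr p) \<partial>lborel \<partial>lborel)"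
    unfolding K_def by (subst nn_integral_add [symmetric]; (subst nn_integral_add [symmetric])?) measurable
  also have "(\<integral>\<^sup>+ w. \<integral>\<^sup>+ w'. K w w' * B (?r w w') * ennreal (norm (f w') powr p) \<partial>lborel \<partial>lborel)
    = (\<integral>\<^sup>+ w'. \<integral>\<^sup>+ w. K w w' * B (?r w w') * ennreal (norm (f w') powr p) \<partial>lborel \<partial>lborel)"
    unfolding K_def by (rule lborel_pair.Fubini') measurable
  also have "\<dots> = (\<integral>\<^sup>+ w'. \<integral>\<^sup>+ w. K w' w * B' (?r w' w) * ennreal (norm (f w') powr p) \<partial>lborel \<partial>lborel)"
    by (simp add: B'_def K_commute)
  also have "\<dots> = c * unit_kernel_integral s \<eta> B' * N"
    by (rule nn_integral_kernel_weight) measurable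
  finally have "c * (unit_kernel_integral s \<eta> Q + unit_kernel_integral s \<eta> ?P) * N
    \<le> ?D + c * unit_kernel_integral s \<eta> Q * N"
    by (simp only: A_int Q_inv)
  then have "c * unit_kernel_integral s \<eta> Q * N + c * unit_kernel_integral s \<eta> ?P * N
    \<le> c * unit_kernel_integral s \<eta> Q * N + ?D"
    by (simp add: distrib_left distrib_right add.commute)
  moreover have "c * unit_kernel_integral s \<eta> Q * N < \<infinity>"
    using Q_fin N_finite by (simp add: ennreal_mult_less_top c_def)
  ultimately show ?thesis by (auto simp: ennreal_add_left_cancel_le)
qed

text \<open>
The regions \<open>|v'| > \<rho> |v|\<close> and \<open>|v| > \<rho> |v'|\<close> are disjoint and are exchanged by swapping \<open>w\<close> and \<open>w'\<close>,
which leaves the energy density unchanged.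
\<close>

lemma energy_ge_truncated:
  assumes \<rho>: "1 < \<rho>"
  shows "2 * (\<integral>\<^sup>+ w. \<integral>\<^sup>+ w'. K w w' * ennreal (norm (f w - f w') powr p)
          * indicator {\<rho><..} (norm (snd w') / norm (snd w)) \<partial>lborel \<partial>lborel)
    \<le> (\<integral>\<^sup>+ w. \<integral>\<^sup>+ w'. K w w' * ennreal (norm (f w - f w') powr p) \<partial>lborel \<partial>lborel)"
    (is "2 * ?D \<le> ?E")
proof -
  let ?r = "\<lambda>w w'. norm (snd w') / norm (snd w)"
  let ?J = "\<lambda>w w'. K w w' * ennreal (norm (f w - f w') powr p)"
  let ?i = "\<lambda>w w'. indicator {\<rho><..} (?r w w') :: ennreal"
  have "?D = (\<integral>\<^sup>+ w'. \<integral>\<^sup>+ w. ?J w w' * ?i w w' \<partial>lborel \<partial>lborel)"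
    unfolding K_def by (rule lborel_pair.Fubini') measurable
  also have "\<dots> = (\<integral>\<^sup>+ w. \<integral>\<^sup>+ w'. ?J w w' * ?i w' w \<partial>lborel \<partial>lborel)"
    by (simp add: K_def norm_minus_commute)
  finally have "2 * ?D = ?D + (\<integral>\<^sup>+ w. \<integral>\<^sup>+ w'. ?J w w' * ?i w' w \<partial>lborel \<partial>lborel)"
    by (simp add: mult_2)
  also have "\<dots> = (\<integral>\<^sup>+ w. \<integral>\<^sup>+ w'. ?J w w' * ?i w w' + ?J w w' * ?i w' w \<partial>lborel \<partial>lborel)"
    unfolding K_def by (subst nn_integral_add [symmetric]; (subst nn_integral_add [symmetric])?) measurable
  also have "\<dots> \<le> ?E"
  proof (intro nn_integral_mono)
    fix w w' :: "'a \<times> (real ^ 'm)"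
    have "\<not> (\<rho> < ?r w w' \<and> \<rho> < ?r w' w)"
    proof
      assume "\<rho> < ?r w w' \<and> \<rho> < ?r w' w"
      then have "1 < ?r w w'" "1 < ?r w' w" using \<rho> by auto
      then show False by (auto simp: less_divide_eq_1)
    qed
    then have "?i w w' + ?i w' w \<le> 1" by (auto simp: indicator_def)
    then have "?J w w' * (?i w w' + ?i w' w) \<le> ?J w w' * 1" by (rule mult_left_mono) simp
    then show "?J w w' * ?i w w' + ?J w w' * ?i w' w \<le> ?J w w'" by (simp add: distrib_left)
  qed
  finally show ?thesis .
qed

lemma energy_ge:
  "c * unit_kernel_integral s \<eta> (\<lambda>r. ennreal (\<bar>1 - r powr (- \<mu>)\<bar> powr p)) * N
    \<le> (\<integral>\<^sup>+ w. \<integral>\<^sup>+ w'. K w w' * ennreal (norm (f w - f w') powr p) \<partial>lborel \<partial>lborel)"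
    (is "_ \<le> ?E")
proof -
  let ?P = "\<lambda>\<rho> r. ennreal (indicator {\<rho><..} r * (1 - r powr (- \<mu>)) powr p)"
  \<comment> \<open>The truncation is removed along a sequence decreasing to 1, by monotone convergence.\<close>
  define \<rho> where "\<rho> k = 1 + 1 / (real k + 1)" for k
  have \<rho>: "1 < \<rho> k" for k by (simp add: \<rho>_def)
  have "unit_kernel_integral s \<eta> (?P 1) = (\<integral>\<^sup>+ z. (SUP k. ennreal (norm (z - \<eta>) powr (- s)) * ?P (\<rho> k) (norm z)) \<partial>lborel)"
    unfolding unit_kernel_integral_def
  proof (rule nn_integral_cong)
    fix z :: "real ^ 'm"
    have "?P 1 (norm z) = (SUP k. ?P (\<rho> k) (norm z))"
    proof (rule antisym)
      show "?P 1 (norm z) \<le> (SUP k. ?P (\<rho> k) (norm z))"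
      proof (cases "1 < norm z")
        case True
        then obtain k where "inverse (real (Suc k)) < norm z - 1"
          using reals_Archimedean[of "norm z - 1"] by auto
        then have "\<rho> k < norm z" by (simp add: \<rho>_def inverse_eq_divide add.commute)
        then have "?P 1 (norm z) \<le> ?P (\<rho> k) (norm z)" using True by simp
        also have "\<dots> \<le> (SUP k. ?P (\<rho> k) (norm z))" by (rule SUP_upper) simp
        finally show ?thesis .
      qed simp
      show "(SUP k. ?P (\<rho> k) (norm z)) \<le> ?P 1 (norm z)"
      proof (rule SUP_least)
        fix k show "?P (\<rho> k) (norm z) \<le> ?P 1 (norm z)"
          using \<rho>[of k] by (auto simp: indicator_def)
      qed
    qed
    then show "ennreal (norm (z - \<eta>) powr (- s)) * ?P 1 (norm z)
      = (SUP k. ennreal (norm (z - \<eta>) powr (- s)) * ?P (\<rho> k) (norm z))"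
      by (simp add: SUP_mult_left_ennreal)
  qed
  also have "\<dots> = (SUP k. unit_kernel_integral s \<eta> (?P (\<rho> k)))"
    unfolding unit_kernel_integral_def
  proof (rule nn_integral_monotone_convergence_SUP)
    show "incseq (\<lambda>k z. ennreal (norm (z - \<eta>) powr (- s)) * ?P (\<rho> k) (norm z))"
    proof (intro incseq_SucI le_funI mult_left_mono)
      fix k and z :: "real ^ 'm"
      have "\<rho> (Suc k) \<le> \<rho> k" by (simp add: \<rho>_def frac_le)
      then show "?P (\<rho> k) (norm z) \<le> ?P (\<rho> (Suc k)) (norm z)" by (auto simp: indicator_def)
    qed simp
  qed measurable
  finally have SUP: "unit_kernel_integral s \<eta> (?P 1) = (SUP k. unit_kernel_integral s \<eta> (?P (\<rho> k)))" .
  have "c * (2 * unit_kernel_integral s \<eta> (?P 1)) * N = 2 * c * N * unit_kernel_integral s \<eta> (?P 1)"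
    by (simp only: mult_ac)
  also have "\<dots> = (SUP k. 2 * c * N * unit_kernel_integral s \<eta> (?P (\<rho> k)))"
    unfolding SUP by (rule SUP_mult_left_ennreal)
  also have "\<dots> \<le> ?E"
  proof (rule SUP_least)
    fix k
    have "2 * c * N * unit_kernel_integral s \<eta> (?P (\<rho> k)) = 2 * (c * unit_kernel_integral s \<eta> (?P (\<rho> k)) * N)"
      by (simp only: mult_ac)
    also have "\<dots> \<le> 2 * (\<integral>\<^sup>+ w. \<integral>\<^sup>+ w'. K w w' * ennreal (norm (f w - f w') powr p)
          * indicator {\<rho> k<..} (norm (snd w') / norm (snd w)) \<partial>lborel \<partial>lborel)"
      by (intro mult_left_mono truncated_energy_ge \<rho>) simp
    also have "\<dots> \<le> ?E" by (rule energy_ge_truncated[OF \<rho>])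
    finally show "2 * c * N * unit_kernel_integral s \<eta> (?P (\<rho> k)) \<le> ?E" .
  qed
  finally show ?thesis
    using unit_kernel_integral_ratio_powr[OF \<eta> \<mu>_pos \<mu>_times_p] by simp
qed

end

theorem theorem12:
  fixes f :: "(real ^ 'n) \<times> (real ^ 'm) \<Rightarrow> complex"
    and p \<beta> :: real
  assumes "schwartz f"
    and "0 < \<beta>" and "\<beta> < 1"
    and "1 \<le> p" and "p < real CARD('m) / \<beta>"
  shows
    "(\<forall>\<eta> :: real ^ 'm. norm \<eta> = 1 \<longrightarrow>
        (\<integral>\<^sup>+ (w, w'). ennreal (norm (f w - f w') powr p
              / norm (w - w') powr (real CARD('n) + real CARD('m) + p * \<beta>))
           \<partial>(lborel \<Otimes>\<^sub>M lborel))
        \<ge> hardy_const CARD('n) p \<beta> \<eta> *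
          (\<integral>\<^sup>+ (x, v). ennreal (norm v powr (- p * \<beta>) * norm (f (x, v)) powr p) \<partial>lborel))
     \<and> (\<forall>(\<eta> :: real ^ 'm) (\<eta>' :: real ^ 'm). norm \<eta> = 1 \<longrightarrow> norm \<eta>' = 1 \<longrightarrow>
          hardy_const CARD('n) p \<beta> \<eta> = hardy_const CARD('n) p \<beta> \<eta>')"
proof (intro conjI allI impI)
  have a: "0 < p * \<beta>" "p * \<beta> < real CARD('m)"
    using assms by (simp_all add: pos_less_divide_eq)
  have [measurable]: "f \<in> borel_measurable borel" using assms(1) by (rule schwartz_borel_measurable)
  have fin: "(\<integral>\<^sup>+ w. ennreal (norm (snd w) powr (- (p * \<beta>)) * norm (f w) powr p) \<partial>lborel) < \<infinity>"
    using schwartz_weighted_norm_finite[OF assms(1,4) a(1)] a(2) by simp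
  have weight: "(\<lambda>(x, v). ennreal (norm v powr (- p * \<beta>) * norm (f (x, v)) powr p))
    = (\<lambda>w. ennreal (norm (snd w) powr (- (p * \<beta>)) * norm (f w) powr p))"
    by (rule ext) (simp add: split_beta)
  fix \<eta> :: "real ^ 'm" assume \<eta>: "norm \<eta> = 1"
  have "hardy_const CARD('n) p \<beta> \<eta> *
      (\<integral>\<^sup>+ w. ennreal (norm (snd w) powr (- (p * \<beta>)) * norm (f w) powr p) \<partial>lborel)
    \<le> (\<integral>\<^sup>+ w. \<integral>\<^sup>+ w'. ennreal (1 / norm (w - w') powr (real DIM(real ^ 'n) + (real CARD('m) + p * \<beta>)))
        * ennreal (norm (f w - f w') powr p) \<partial>lborel \<partial>lborel)"
    using energy_ge[OF _ assms(4) a \<eta> fin] by (simp add: hardy_const_eq)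
  also have "\<dots> = (\<integral>\<^sup>+ w. \<integral>\<^sup>+ w'. ennreal (norm (f w - f w') powr p
      / norm (w - w') powr (real CARD('n) + real CARD('m) + p * \<beta>)) \<partial>lborel \<partial>lborel)"
    by (simp add: ennreal_mult' [symmetric] add.assoc)
  also have "\<dots> = (\<integral>\<^sup>+ (w, w'). ennreal (norm (f w - f w') powr p
      / norm (w - w') powr (real CARD('n) + real CARD('m) + p * \<beta>)) \<partial>(lborel \<Otimes>\<^sub>M lborel))"
    by (subst lborel.nn_integral_fst [symmetric]) simp_all
  finally show "hardy_const CARD('n) p \<beta> \<eta> *
      (\<integral>\<^sup>+ (x, v). ennreal (norm v powr (- p * \<beta>) * norm (f (x, v)) powr p) \<partial>lborel)
    \<le> (\<integral>\<^sup>+ (w, w'). ennreal (norm (f w - f w') powr p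
      / norm (w - w') powr (real CARD('n) + real CARD('m) + p * \<beta>)) \<partial>(lborel \<Otimes>\<^sub>M lborel))"
    unfolding weight .
next
  fix \<eta> \<eta>' :: "real ^ 'm" assume "norm \<eta> = 1" "norm \<eta>' = 1"
  then show "hardy_const CARD('n) p \<beta> \<eta> = hardy_const CARD('n) p \<beta> \<eta>'"
    unfolding hardy_const_eq by (intro arg_cong2[where f="(*)"] refl unit_kernel_integral_rotate) auto
qed

end
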